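(* Let $\mathcal{B}$ be a category with a coproduct $\sqcup$ (with a coproduct of any two objects and an initial object $\emptyset$ chosen), let $(\mathcal{C}_s,\sqcup)$ be a symmetric monoidal category, and let $$\mathcal{C}_s \xrightarrow{S} \mathcal{B} \xleftarrow{T} \mathcal{C}_t$$ be a cospan of categories, where $S:(\mathcal{C}_s,\sqcup)\to(\mathcal{B},\sqcup)$ is a strict monoidal functor and $T:\mathcal{C}_t\to\mathcal{B}$ is just a functor. Let $\mathcal{H}:\mathcal{B}\to\mathcal{AB}$ be an additive functor to the category $\mathcal{AB}$ of abelian groups, and put $T'=\mathcal{H}\circ T$. Then an additive invariant $\alpha$ on $ob(\mathcal{C}_s)$ with values in $\mathcal{H}$ induces a natural transformation of functors $\mathcal{C}_t\to\mathcal{AB}$ $$\tau_\alpha: K_\alpha\bigl(\mathcal{C}_s\xrightarrow{S}\mathcal{B}/T(-)\bigr)\to T'(-),\qquad \tau_\alpha([(V,X,h)]_\alpha):=h_*(\alpha(V)).$$ Assume moreover that $T$ is full, and consider one of the following two cases: (i) $\mathcal{C}_t=\mathcal{B}$ and $T=\mathrm{id}_{\mathcal{B}}$; (ii) $\mathcal{C}_t=\mathcal{C}_s$ and $T=S$. Then $\tau_\alpha$ is the unique natural transformation $K_\alpha(\mathcal{C}_s\xrightarrow{S}\mathcal{B}/T(-))\to T'(-)$ satisfying, for all $V\in ob(\mathcal{C}_s)$, $$\tau_\alpha([(V,S(V),\mathrm{id}_{S(V)})]_\alpha)=\alpha(V)\ \text{ in case (i)},\qquad \tau_\alpha([(V,V,\mathrm{id}_{S(V)})]_\alpha)=\alpha(V)\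 \text{ in case (ii)}.$$
   Context: The chosen coproducts and initial object make $(\mathcal{B},\sqcup,\emptyset)$ a symmetric monoidal category. A strict monoidal functor $S$ between symmetric monoidal categories satisfies $S(V\sqcup V')=S(V)\sqcup S(V')$ and $S(\emptyset)=\emptyset$, and carries the associativity, unit and symmetry constraints to those of $\mathcal{B}$. A covariant functor $\mathcal{H}:\mathcal{B}\to\mathcal{AB}$ is additive if for all objects $X,Y$ the map $(i_X)_*\oplus(i_Y)_*:\mathcal{H}(X)\oplus\mathcal{H}(Y)\to\mathcal{H}(X\sqcup Y)$ is an isomorphism, where $i_X,i_Y$ are the canonical injections; in particular $\mathcal{H}(\emptyset)=\{0\}$. For a morphism $h$ of $\mathcal{B}$ write $h_*=\mathcal{H}(h)$. An additive invariant $\alpha$ on $ob(\mathcal{C}_s)$ with values in $\mathcal{H}$ is an assignment of an element $\alpha(V)\in\mathcal{H}(S(V))$ to every $V\in ob(\mathcal{C}_s)$ such that $\alpha(V\sqcup V')=(i_{S(V)})_*\alpha(V)+(i_{S(V')})_*\alpha(V')$. For $X\in ob(\mathcal{C}_t)$ consider triples $(V,X,h)$ with $V\in ob(\mathcal{C}_s)$ and $h\in hom_{\mathcal{B}}(S(V),T(X))$. Two triples $(V,X,h)$, $(V',X,h')$ are $\alpha$-isomorphic if there is an isomorphism $\phi:V\to V'$ in $\mathcal{C}_s$ with $h'\circ S(\phi)=h$ and $(S(\phi))_*\alpha(V)=\alpha(V')$. The $\alpha$-isomorphism classes $[(V,X,h)]_\alpha$ form a commutative monoid under $[(V,X,h)]_\alpha\sqcup[(V',X,h')]_\alpha:=[(V\sqcup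 V',X,h+h')]_\alpha$, where $h+h':S(V)\sqcup S(V')\to T(X)$ is the morphism induced by $h,h'$, with unit the class of $(\emptyset,X,\emptyset\to T(X))$. Its group completion is denoted $K_\alpha(\mathcal{C}_s\xrightarrow{S}\mathcal{B}/T(X))$. It is a covariant functor of $X\in\mathcal{C}_t$: a morphism $f:X\to X'$ of $\mathcal{C}_t$ sends $[(V,X,h)]_\alpha$ to $[(V,X',T(f)\circ h)]_\alpha$. *)

theory Defs
  imports "HOL-Algebra.Group"
begin

section \<open>Categories and functors\<close>

record ('o, 'm) cat =
  Ob :: "'o set"
  Arr :: "'m set"
  Dom :: "'m \<Rightarrow> 'o"
  Cod :: "'m \<Rightarrow> 'o"
  Ide :: "'o \<Rightarrow> 'm"
  Comp :: "'m \<Rightarrow> 'm \<Rightarrow> 'm"  (infixl \<open>\<cdot>\<index>\<close> 75)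

definition Hom :: "('o, 'm, 'z) cat_scheme \<Rightarrow> 'o \<Rightarrow> 'o \<Rightarrow> 'm set" where
  "Hom C X Y = {f \<in> Arr C. Dom C f = X \<and> Cod C f = Y}"

locale category =
  fixes C :: "('o, 'm, 'z) cat_scheme" (structure)
  assumes Dom_in: "f \<in> Arr C \<Longrightarrow> Dom C f \<in> Ob C"
    and Cod_in: "f \<in> Arr C \<Longrightarrow> Cod C f \<in> Ob C"
    and Ide_in: "X \<in> Ob C \<Longrightarrow> Ide C X \<in> Hom C X X"
    and Comp_in: "\<lbrakk>f \<in> Hom C X Y; g \<in> Hom C Y Z\<rbrakk> \<Longrightarrow> g \<cdot> f \<in> Hom C X Z"
    and Comp_Ide: "f \<in> Hom C X Y \<Longrightarrow> f \<cdot> Ide C X = f"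
    and Ide_Comp: "f \<in> Hom C X Y \<Longrightarrow> Ide C Y \<cdot> f = f"
    and Comp_assoc: "\<lbrakk>f \<in> Hom C W X; g \<in> Hom C X Y; h \<in> Hom C Y Z\<rbrakk>
                      \<Longrightarrow> (h \<cdot> g) \<cdot> f = h \<cdot> (g \<cdot> f)"

definition Iso :: "('o, 'm, 'z) cat_scheme \<Rightarrow> 'o \<Rightarrow> 'o \<Rightarrow> 'm set" where
  "Iso C X Y = {f \<in> Hom C X Y. \<exists>g \<in> Hom C Y X.
                  g \<cdot>\<^bsub>C\<^esub> f = Ide C X \<and> f \<cdot>\<^bsub>C\<^esub> g = Ide C Y}"

text \<open>An object map and an arrow map. Instantiated with \<open>'p = 'g monoid\<close> and
  \<open>'n = 'g \<Rightarrow> 'g\<close>, the same record also carries functors to abelian groups.\<close>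

record ('o, 'm, 'p, 'n) fun_data =
  FO :: "'o \<Rightarrow> 'p"
  FA :: "'m \<Rightarrow> 'n"

definition id_fun :: "('o, 'm, 'o, 'm) fun_data" where
  "id_fun = \<lparr>FO = (\<lambda>X. X), FA = (\<lambda>f. f)\<rparr>"

definition comp_fun ::
    "('p, 'n, 'q, 'k) fun_data \<Rightarrow> ('o, 'm, 'p, 'n) fun_data \<Rightarrow> ('o, 'm, 'q, 'k) fun_data" where
  "comp_fun G F = \<lparr>FO = (\<lambda>X. FO G (FO F X)), FA = (\<lambda>f. FA G (FA F f))\<rparr>"

locale cat_functor = C: category C + D: category D
  for C :: "('o, 'm, 'y) cat_scheme" and D :: "('p, 'n, 'z) cat_scheme" +
  fixes F :: "('o, 'm, 'p, 'n) fun_data"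
  assumes FO_in: "X \<in> Ob C \<Longrightarrow> FO F X \<in> Ob D"
    and FA_in: "f \<in> Hom C X Y \<Longrightarrow> FA F f \<in> Hom D (FO F X) (FO F Y)"
    and FA_Ide: "X \<in> Ob C \<Longrightarrow> FA F (Ide C X) = Ide D (FO F X)"
    and FA_Comp: "\<lbrakk>f \<in> Hom C X Y; g \<in> Hom C Y Z\<rbrakk>
                   \<Longrightarrow> FA F (g \<cdot>\<^bsub>C\<^esub> f) = FA F g \<cdot>\<^bsub>D\<^esub> FA F f"

definition full_functor ::
    "('o, 'm, 'y) cat_scheme \<Rightarrow> ('p, 'n, 'z) cat_scheme \<Rightarrow> ('o, 'm, 'p, 'n) fun_data \<Rightarrow> bool" where
  "full_functor C D F \<longleftrightarrow> cat_functor C D F \<and>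
     (\<forall>X \<in> Ob C. \<forall>Y \<in> Ob C. FA F ` Hom C X Y = Hom D (FO F X) (FO F Y))"

section \<open>Symmetric monoidal categories and strict monoidal functors\<close>

record ('o, 'm) smcat = "('o, 'm) cat" +
  tens :: "'o \<Rightarrow> 'o \<Rightarrow> 'o"  (infixl \<open>\<boxplus>\<index>\<close> 65)
  tensA :: "'m \<Rightarrow> 'm \<Rightarrow> 'm"  (infixl \<open>\<oplus>\<index>\<close> 65)
  munit :: 'o
  massoc :: "'o \<Rightarrow> 'o \<Rightarrow> 'o \<Rightarrow> 'm"
  lunit :: "'o \<Rightarrow> 'm"
  runit :: "'o \<Rightarrow> 'm"
  braid :: "'o \<Rightarrow> 'o \<Rightarrow> 'm"

locale symmetric_monoidal_category = category C
  for C :: "('o, 'm, 'z) smcat_scheme" (structure) +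
  assumes tens_in: "\<lbrakk>X \<in> Ob C; Y \<in> Ob C\<rbrakk> \<Longrightarrow> X \<boxplus> Y \<in> Ob C"
    and tensA_in: "\<lbrakk>f \<in> Hom C X X'; g \<in> Hom C Y Y'\<rbrakk>
          \<Longrightarrow> f \<oplus> g \<in> Hom C (X \<boxplus> Y) (X' \<boxplus> Y')"
    and tensA_Ide: "\<lbrakk>X \<in> Ob C; Y \<in> Ob C\<rbrakk> \<Longrightarrow> Ide C X \<oplus> Ide C Y = Ide C (X \<boxplus> Y)"
    and tensA_Comp: "\<lbrakk>f \<in> Hom C X X'; f' \<in> Hom C X' X''; g \<in> Hom C Y Y'; g' \<in> Hom C Y' Y''\<rbrakk>
          \<Longrightarrow> (f' \<cdot> f) \<oplus> (g' \<cdot> g) = (f' \<oplus> g') \<cdot> (f \<oplus> g)"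
    and munit_in: "munit C \<in> Ob C"
    and massoc_iso: "\<lbrakk>X \<in> Ob C; Y \<in> Ob C; Z \<in> Ob C\<rbrakk>
          \<Longrightarrow> massoc C X Y Z \<in> Iso C ((X \<boxplus> Y) \<boxplus> Z) (X \<boxplus> (Y \<boxplus> Z))"
    and lunit_iso: "X \<in> Ob C \<Longrightarrow> lunit C X \<in> Iso C (munit C \<boxplus> X) X"
    and runit_iso: "X \<in> Ob C \<Longrightarrow> runit C X \<in> Iso C (X \<boxplus> munit C) X"
    and braid_iso: "\<lbrakk>X \<in> Ob C; Y \<in> Ob C\<rbrakk> \<Longrightarrow> braid C X Y \<in> Iso C (X \<boxplus> Y) (Y \<boxplus> X)"
    and massoc_natural: "\<lbrakk>f \<in> Hom C X X'; g \<in> Hom C Y Y'; h \<in> Hom C Z Z'\<rbrakk>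
          \<Longrightarrow> massoc C X' Y' Z' \<cdot> ((f \<oplus> g) \<oplus> h) = (f \<oplus> (g \<oplus> h)) \<cdot> massoc C X Y Z"
    and lunit_natural: "f \<in> Hom C X X'
          \<Longrightarrow> lunit C X' \<cdot> (Ide C (munit C) \<oplus> f) = f \<cdot> lunit C X"
    and runit_natural: "f \<in> Hom C X X'
          \<Longrightarrow> runit C X' \<cdot> (f \<oplus> Ide C (munit C)) = f \<cdot> runit C X"
    and braid_natural: "\<lbrakk>f \<in> Hom C X X'; g \<in> Hom C Y Y'\<rbrakk>
          \<Longrightarrow> braid C X' Y' \<cdot> (f \<oplus> g) = (g \<oplus> f) \<cdot> braid C X Y"
    and pentagon: "\<lbrakk>W \<in> Ob C; X \<in> Ob C; Y \<in> Ob C; Z \<in> Ob C\<rbrakk>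
          \<Longrightarrow> massoc C W X (Y \<boxplus> Z) \<cdot> massoc C (W \<boxplus> X) Y Z
            = (Ide C W \<oplus> massoc C X Y Z) \<cdot> massoc C W (X \<boxplus> Y) Z
                \<cdot> (massoc C W X Y \<oplus> Ide C Z)"
    and triangle: "\<lbrakk>X \<in> Ob C; Y \<in> Ob C\<rbrakk>
          \<Longrightarrow> (Ide C X \<oplus> lunit C Y) \<cdot> massoc C X (munit C) Y = runit C X \<oplus> Ide C Y"
    and hexagon: "\<lbrakk>X \<in> Ob C; Y \<in> Ob C; Z \<in> Ob C\<rbrakk>
          \<Longrightarrow> massoc C Y Z X \<cdot> braid C X (Y \<boxplus> Z) \<cdot> massoc C X Y Z
            = (Ide C Y \<oplus> braid C X Z) \<cdot> massoc C Y X Z \<cdot> (braid C X Y \<oplus> Ide C Z)"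
    and braid_braid: "\<lbrakk>X \<in> Ob C; Y \<in> Ob C\<rbrakk>
          \<Longrightarrow> braid C Y X \<cdot> braid C X Y = Ide C (X \<boxplus> Y)"

locale strict_monoidal_functor = cat_functor C D F
  for C :: "('o, 'm, 'y) smcat_scheme" and D :: "('p, 'n, 'z) smcat_scheme"
    and F :: "('o, 'm, 'p, 'n) fun_data" +
  assumes FO_tens: "\<lbrakk>X \<in> Ob C; Y \<in> Ob C\<rbrakk> \<Longrightarrow> FO F (X \<boxplus>\<^bsub>C\<^esub> Y) = FO F X \<boxplus>\<^bsub>D\<^esub> FO F Y"
    and FA_tensA: "\<lbrakk>f \<in> Arr C; g \<in> Arr C\<rbrakk> \<Longrightarrow> FA F (f \<oplus>\<^bsub>C\<^esub> g) = FA F f \<oplus>\<^bsub>D\<^esub> FA F g"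
    and FO_munit: "FO F (munit C) = munit D"
    and FA_massoc: "\<lbrakk>X \<in> Ob C; Y \<in> Ob C; Z \<in> Ob C\<rbrakk>
          \<Longrightarrow> FA F (massoc C X Y Z) = massoc D (FO F X) (FO F Y) (FO F Z)"
    and FA_lunit: "X \<in> Ob C \<Longrightarrow> FA F (lunit C X) = lunit D (FO F X)"
    and FA_runit: "X \<in> Ob C \<Longrightarrow> FA F (runit C X) = runit D (FO F X)"
    and FA_braid: "\<lbrakk>X \<in> Ob C; Y \<in> Ob C\<rbrakk>
          \<Longrightarrow> FA F (braid C X Y) = braid D (FO F X) (FO F Y)"

section \<open>Chosen coproducts\<close>

record ('o, 'm) cpcat = "('o, 'm) cat" +
  cop :: "'o \<Rightarrow> 'o \<Rightarrow> 'o"  (infixl \<open>\<uplus>\<index>\<close> 65)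
  inj1 :: "'o \<Rightarrow> 'o \<Rightarrow> 'm"
  inj2 :: "'o \<Rightarrow> 'o \<Rightarrow> 'm"
  init :: 'o

locale coproduct_category = category B
  for B :: "('o, 'm, 'z) cpcat_scheme" (structure) +
  assumes cop_in: "\<lbrakk>X \<in> Ob B; Y \<in> Ob B\<rbrakk> \<Longrightarrow> X \<uplus> Y \<in> Ob B"
    and inj1_in: "\<lbrakk>X \<in> Ob B; Y \<in> Ob B\<rbrakk> \<Longrightarrow> inj1 B X Y \<in> Hom B X (X \<uplus> Y)"
    and inj2_in: "\<lbrakk>X \<in> Ob B; Y \<in> Ob B\<rbrakk> \<Longrightarrow> inj2 B X Y \<in> Hom B Y (X \<uplus> Y)"
    and cop_universal: "\<lbrakk>f \<in> Hom B X Z; g \<in> Hom B Y Z\<rbrakk>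
          \<Longrightarrow> \<exists>!k. k \<in> Hom B (X \<uplus> Y) Z \<and> k \<cdot> inj1 B X Y = f \<and> k \<cdot> inj2 B X Y = g"
    and init_in: "init B \<in> Ob B"
    and init_universal: "X \<in> Ob B \<Longrightarrow> \<exists>!k. k \<in> Hom B (init B) X"

text \<open>The morphism written \<open>h + h'\<close> in the mathematics.\<close>

definition copair :: "('o, 'm, 'z) cpcat_scheme \<Rightarrow> 'm \<Rightarrow> 'm \<Rightarrow> 'm" where
  "copair B f g = (THE k. k \<in> Hom B (Dom B f \<uplus>\<^bsub>B\<^esub> Dom B g) (Cod B f) \<and>
      k \<cdot>\<^bsub>B\<^esub> inj1 B (Dom B f) (Dom B g) = f \<and> k \<cdot>\<^bsub>B\<^esub> inj2 B (Dom B f) (Dom B g) = g)"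

definition from_init :: "('o, 'm, 'z) cpcat_scheme \<Rightarrow> 'o \<Rightarrow> 'm" where
  "from_init B X = (THE k. k \<in> Hom B (init B) X)"

definition coproduct_smcat :: "('o, 'm, 'z) cpcat_scheme \<Rightarrow> ('o, 'm) smcat" where
  "coproduct_smcat B = \<lparr>
     Ob = Ob B, Arr = Arr B, Dom = Dom B, Cod = Cod B, Ide = Ide B, Comp = Comp B,
     tens = cop B,
     tensA = (\<lambda>f g. copair B (inj1 B (Cod B f) (Cod B g) \<cdot>\<^bsub>B\<^esub> f) (inj2 B (Cod B f) (Cod B g) \<cdot>\<^bsub>B\<^esub> g)),
     munit = init B,
     massoc = (\<lambda>X Y Z. copair B
        (copair B (inj1 B X (Y \<uplus>\<^bsub>B\<^esub> Z)) (inj2 B X (Y \<uplus>\<^bsub>B\<^esub> Z) \<cdot>\<^bsub>B\<^esub> inj1 B Y Z))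
        (inj2 B X (Y \<uplus>\<^bsub>B\<^esub> Z) \<cdot>\<^bsub>B\<^esub> inj2 B Y Z)),
     lunit = (\<lambda>X. copair B (from_init B X) (Ide B X)),
     runit = (\<lambda>X. copair B (Ide B X) (from_init B X)),
     braid = (\<lambda>X Y. copair B (inj2 B Y X) (inj1 B Y X))\<rparr>"

section \<open>Functors to abelian groups\<close>

text \<open>Abelian groups are written multiplicatively. Each functor takes its values in groups whose
  carriers are subsets of one type; a natural transformation may relate functors with different
  such types. Arrow maps are only relevant on carriers, so equalities of homomorphisms are
  equalities on carriers.\<close>

locale ab_functor = category C
  for C :: "('o, 'm, 'z) cat_scheme" (structure) +
  fixes F :: "('o, 'm, 'g monoid, 'g \<Rightarrow> 'g) fun_data"
  assumes FO_group: "X \<in> Ob C \<Longrightarrow> comm_group (FO F X)"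
    and FA_hom: "f \<in> Hom C X Y \<Longrightarrow> FA F f \<in> hom (FO F X) (FO F Y)"
    and FA_Ide: "\<lbrakk>X \<in> Ob C; x \<in> carrier (FO F X)\<rbrakk> \<Longrightarrow> FA F (Ide C X) x = x"
    and FA_Comp: "\<lbrakk>f \<in> Hom C X Y; g \<in> Hom C Y Z; x \<in> carrier (FO F X)\<rbrakk>
                   \<Longrightarrow> FA F (g \<cdot> f) x = FA F g (FA F f x)"

locale ab_nat_trans = F: ab_functor C F + G: ab_functor C G
  for C :: "('o, 'm, 'z) cat_scheme"
    and F :: "('o, 'm, 'g monoid, 'g \<Rightarrow> 'g) fun_data"
    and G :: "('o, 'm, 'h monoid, 'h \<Rightarrow> 'h) fun_data" +
  fixes \<tau> :: "'o \<Rightarrow> 'g \<Rightarrow> 'h"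
  assumes component_hom: "X \<in> Ob C \<Longrightarrow> \<tau> X \<in> hom (FO F X) (FO G X)"
    and natural: "\<lbrakk>f \<in> Hom C X Y; x \<in> carrier (FO F X)\<rbrakk>
                   \<Longrightarrow> \<tau> Y (FA F f x) = FA G f (\<tau> X x)"

locale additive_functor = coproduct_category B + ab_functor B H
  for B :: "('o, 'm, 'z) cpcat_scheme" (structure)
    and H :: "('o, 'm, 'g monoid, 'g \<Rightarrow> 'g) fun_data" +
  assumes additive: "\<lbrakk>X \<in> Ob B; Y \<in> Ob B\<rbrakk> \<Longrightarrow>
     (\<lambda>(x, y). FA H (inj1 B X Y) x \<otimes>\<^bsub>FO H (X \<uplus> Y)\<^esub> FA H (inj2 B X Y) y)
       \<in> iso (FO H X \<times>\<times> FO H Y) (FO H (X \<uplus> Y))"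

section \<open>Group completion\<close>

definition completion_rel :: "('a, 'b) monoid_scheme \<Rightarrow> (('a \<times> 'a) \<times> ('a \<times> 'a)) set" where
  "completion_rel M = {((a, b), (c, d)). a \<in> carrier M \<and> b \<in> carrier M \<and>
     c \<in> carrier M \<and> d \<in> carrier M \<and>
     (\<exists>k \<in> carrier M. a \<otimes>\<^bsub>M\<^esub> d \<otimes>\<^bsub>M\<^esub> k = c \<otimes>\<^bsub>M\<^esub> b \<otimes>\<^bsub>M\<^esub> k)}"

definition group_completion :: "('a, 'b) monoid_scheme \<Rightarrow> ('a \<times> 'a) set monoid" where
  "group_completion M = \<lparr>
     carrier = (carrier M \<times> carrier M) // completion_rel M,
     mult = (\<lambda>P Q. \<Union>(a, b) \<in> P. \<Union>(c, d) \<in> Q. completion_rel M `` {(a \<otimes>\<^bsub>M\<^esub> c, b \<otimes>\<^bsub>M\<^esub> d)}),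
     one = completion_rel M `` {(\<one>\<^bsub>M\<^esub>, \<one>\<^bsub>M\<^esub>)}\<rparr>"

definition completion_embed :: "('a, 'b) monoid_scheme \<Rightarrow> 'a \<Rightarrow> ('a \<times> 'a) set" where
  "completion_embed M a = completion_rel M `` {(a, \<one>\<^bsub>M\<^esub>)}"

text \<open>The homomorphism of group completions induced by a monoid homomorphism into \<open>N\<close>.\<close>

definition completion_map ::
    "('c, 'd) monoid_scheme \<Rightarrow> ('a \<Rightarrow> 'c) \<Rightarrow> ('a \<times> 'a) set \<Rightarrow> ('c \<times> 'c) set" where
  "completion_map N f P = (\<Union>(a, b) \<in> P. completion_rel N `` {(f a, f b)})"

section \<open>The relative Grothendieck group of a cospan with an additive invariant\<close>

locale additive_invariant =
  fixes Cs :: "('os, 'ms) smcat"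
    and B :: "('ob, 'mb) cpcat"
    and S :: "('os, 'ms, 'ob, 'mb) fun_data"
    and H :: "('ob, 'mb, 'g monoid, 'g \<Rightarrow> 'g) fun_data"
    and \<alpha> :: "'os \<Rightarrow> 'g"
  assumes value_in: "V \<in> Ob Cs \<Longrightarrow> \<alpha> V \<in> carrier (FO H (FO S V))"
    and value_tens: "\<lbrakk>V \<in> Ob Cs; V' \<in> Ob Cs\<rbrakk> \<Longrightarrow>
      \<alpha> (V \<boxplus>\<^bsub>Cs\<^esub> V') =
        FA H (inj1 B (FO S V) (FO S V')) (\<alpha> V)
        \<otimes>\<^bsub>FO H (FO S V \<uplus>\<^bsub>B\<^esub> FO S V')\<^esub> FA H (inj2 B (FO S V) (FO S V')) (\<alpha> V')"

definition alpha_triples ::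
    "('os, 'ms) smcat \<Rightarrow> ('ob, 'mb) cpcat \<Rightarrow> ('os, 'ms, 'ob, 'mb) fun_data
     \<Rightarrow> ('ot, 'mt, 'ob, 'mb) fun_data \<Rightarrow> 'ot \<Rightarrow> ('os \<times> 'ot \<times> 'mb) set" where
  "alpha_triples Cs B S T X =
     {(V, Y, h). V \<in> Ob Cs \<and> Y = X \<and> h \<in> Hom B (FO S V) (FO T X)}"

definition alpha_iso ::
    "('os, 'ms) smcat \<Rightarrow> ('ob, 'mb) cpcat \<Rightarrow> ('os, 'ms, 'ob, 'mb) fun_data
     \<Rightarrow> ('ob, 'mb, 'g monoid, 'g \<Rightarrow> 'g) fun_data \<Rightarrow> ('os \<Rightarrow> 'g)
     \<Rightarrow> ('ot, 'mt, 'ob, 'mb) fun_data \<Rightarrow> 'ot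
     \<Rightarrow> (('os \<times> 'ot \<times> 'mb) \<times> ('os \<times> 'ot \<times> 'mb)) set" where
  "alpha_iso Cs B S H \<alpha> T X = {((V, Y, h), (V', Y', h')).
     (V, Y, h) \<in> alpha_triples Cs B S T X \<and> (V', Y', h') \<in> alpha_triples Cs B S T X \<and>
     (\<exists>\<phi> \<in> Iso Cs V V'. h' \<cdot>\<^bsub>B\<^esub> FA S \<phi> = h \<and> FA H (FA S \<phi>) (\<alpha> V) = \<alpha> V')}"

definition alpha_class ::
    "('os, 'ms) smcat \<Rightarrow> ('ob, 'mb) cpcat \<Rightarrow> ('os, 'ms, 'ob, 'mb) fun_data
     \<Rightarrow> ('ob, 'mb, 'g monoid, 'g \<Rightarrow> 'g) fun_data \<Rightarrow> ('os \<Rightarrow> 'g)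
     \<Rightarrow> ('ot, 'mt, 'ob, 'mb) fun_data
     \<Rightarrow> ('os \<times> 'ot \<times> 'mb) \<Rightarrow> ('os \<times> 'ot \<times> 'mb) set" where
  "alpha_class Cs B S H \<alpha> T = (\<lambda>(V, X, h). alpha_iso Cs B S H \<alpha> T X `` {(V, X, h)})"

definition alpha_monoid ::
    "('os, 'ms) smcat \<Rightarrow> ('ob, 'mb) cpcat \<Rightarrow> ('os, 'ms, 'ob, 'mb) fun_data
     \<Rightarrow> ('ob, 'mb, 'g monoid, 'g \<Rightarrow> 'g) fun_data \<Rightarrow> ('os \<Rightarrow> 'g)
     \<Rightarrow> ('ot, 'mt, 'ob, 'mb) fun_data \<Rightarrow> 'ot \<Rightarrow> ('os \<times> 'ot \<times> 'mb) set monoid" where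
  "alpha_monoid Cs B S H \<alpha> T X = \<lparr>
     carrier = alpha_triples Cs B S T X // alpha_iso Cs B S H \<alpha> T X,
     mult = (\<lambda>P Q. \<Union>(V, _, h) \<in> P. \<Union>(V', _, h') \<in> Q.
               alpha_class Cs B S H \<alpha> T (V \<boxplus>\<^bsub>Cs\<^esub> V', X, copair B h h')),
     one = alpha_class Cs B S H \<alpha> T (munit Cs, X, from_init B (FO T X))\<rparr>"

definition alpha_push ::
    "('os, 'ms) smcat \<Rightarrow> ('ob, 'mb) cpcat \<Rightarrow> ('os, 'ms, 'ob, 'mb) fun_data
     \<Rightarrow> ('ob, 'mb, 'g monoid, 'g \<Rightarrow> 'g) fun_data \<Rightarrow> ('os \<Rightarrow> 'g)
     \<Rightarrow> ('ot, 'mt, 'z) cat_scheme \<Rightarrow> ('ot, 'mt, 'ob, 'mb) fun_data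
     \<Rightarrow> 'mt \<Rightarrow> ('os \<times> 'ot \<times> 'mb) set \<Rightarrow> ('os \<times> 'ot \<times> 'mb) set" where
  "alpha_push Cs B S H \<alpha> Ct T f P =
     (\<Union>(V, _, h) \<in> P. alpha_class Cs B S H \<alpha> T (V, Cod Ct f, FA T f \<cdot>\<^bsub>B\<^esub> h))"

definition K_alpha ::
    "('os, 'ms) smcat \<Rightarrow> ('ob, 'mb) cpcat \<Rightarrow> ('os, 'ms, 'ob, 'mb) fun_data
     \<Rightarrow> ('ob, 'mb, 'g monoid, 'g \<Rightarrow> 'g) fun_data \<Rightarrow> ('os \<Rightarrow> 'g)
     \<Rightarrow> ('ot, 'mt, 'z) cat_scheme \<Rightarrow> ('ot, 'mt, 'ob, 'mb) fun_data
     \<Rightarrow> ('ot, 'mt,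
         (('os \<times> 'ot \<times> 'mb) set \<times> ('os \<times> 'ot \<times> 'mb) set) set monoid,
         (('os \<times> 'ot \<times> 'mb) set \<times> ('os \<times> 'ot \<times> 'mb) set) set
           \<Rightarrow> (('os \<times> 'ot \<times> 'mb) set \<times> ('os \<times> 'ot \<times> 'mb) set) set) fun_data" where
  "K_alpha Cs B S H \<alpha> Ct T = \<lparr>
     FO = (\<lambda>X. group_completion (alpha_monoid Cs B S H \<alpha> T X)),
     FA = (\<lambda>f. completion_map (alpha_monoid Cs B S H \<alpha> T (Cod Ct f))
                 (alpha_push Cs B S H \<alpha> Ct T f))\<rparr>"

definition K_class ::
    "('os, 'ms) smcat \<Rightarrow> ('ob, 'mb) cpcat \<Rightarrow> ('os, 'ms, 'ob, 'mb) fun_data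
     \<Rightarrow> ('ob, 'mb, 'g monoid, 'g \<Rightarrow> 'g) fun_data \<Rightarrow> ('os \<Rightarrow> 'g)
     \<Rightarrow> ('ot, 'mt, 'ob, 'mb) fun_data \<Rightarrow> ('os \<times> 'ot \<times> 'mb)
     \<Rightarrow> (('os \<times> 'ot \<times> 'mb) set \<times> ('os \<times> 'ot \<times> 'mb) set) set" where
  "K_class Cs B S H \<alpha> T = (\<lambda>(V, X, h).
     completion_embed (alpha_monoid Cs B S H \<alpha> T X) (alpha_class Cs B S H \<alpha> T (V, X, h)))"

text \<open>Every element of the group completion is a difference of classes of triples; \<open>tau_alpha\<close> is
  the additive extension of \<open>[(V, X, h)] \<mapsto> h\<^sub>* (\<alpha> V)\<close>. That this is independent of the chosen
  representatives is part of the theorem.\<close>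

definition tau_alpha ::
    "('os, 'ms) smcat \<Rightarrow> ('ob, 'mb) cpcat \<Rightarrow> ('os, 'ms, 'ob, 'mb) fun_data
     \<Rightarrow> ('ob, 'mb, 'g monoid, 'g \<Rightarrow> 'g) fun_data \<Rightarrow> ('os \<Rightarrow> 'g)
     \<Rightarrow> ('ot, 'mt, 'z) cat_scheme \<Rightarrow> ('ot, 'mt, 'ob, 'mb) fun_data
     \<Rightarrow> 'ot \<Rightarrow> (('os \<times> 'ot \<times> 'mb) set \<times> ('os \<times> 'ot \<times> 'mb) set) set \<Rightarrow> 'g" where
  "tau_alpha Cs B S H \<alpha> Ct T X k = (THE a. \<exists>V h V' h'.
     (V, X, h) \<in> alpha_triples Cs B S T X \<and> (V', X, h') \<in> alpha_triples Cs B S T X \<and>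
     k = K_class Cs B S H \<alpha> T (V, X, h)
           \<otimes>\<^bsub>FO (K_alpha Cs B S H \<alpha> Ct T) X\<^esub>
           inv\<^bsub>FO (K_alpha Cs B S H \<alpha> Ct T) X\<^esub> K_class Cs B S H \<alpha> T (V', X, h') \<and>
     a = FA H h (\<alpha> V) \<otimes>\<^bsub>FO H (FO T X)\<^esub> inv\<^bsub>FO H (FO T X)\<^esub> FA H h' (\<alpha> V'))"

end

theory Submission
  imports Defs
begin

text \<open>The value \<open>h\<^sub>* (\<alpha> V)\<close> depends only on the \<open>\<alpha>\<close>-isomorphism class of \<open>(V, X, h)\<close>, and additivity
  of \<open>\<alpha>\<close> makes it a monoid homomorphism, which extends to the group completion. Conversely, \<open>[(V, X, T(f))]\<close>
  is the image of \<open>[(V, Y, id)]\<close> under \<open>f : Y \<rightarrow> X\<close> whenever \<open>T(Y) = S(V)\<close>, so naturality forces its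
  value to be \<open>T(f)\<^sub>* (\<alpha> V)\<close>. In both cases every triple has this form, with \<open>Y = S(V)\<close> or \<open>Y = V\<close>, and
  classes of triples generate the group completion.\<close>

section \<open>Group completion of a commutative monoid\<close>

text \<open>Most of the work precedes the transformation: the \<alpha>-isomorphism classes must be
  shown to form a commutative monoid. Each constraint isomorphism of \<open>Cs\<close> involved has
  to be an \<alpha>-isomorphism, that is, to respect both the arrows to \<open>FO T X\<close> and
  the values of \<alpha>. Strictness of \<open>S\<close> identifies its image with a copairing of
  injections, and applying \<open>H\<close> to such a copairing at a value of \<alpha> is a
  computation with \<open>value_tens\<close>. For the unit law, \<alpha> must be neutral at
  \<open>munit Cs\<close>; this is not among the axioms of an additive invariant and is drawn from
  the vanishing of \<open>H\<close> at the initial object. The monoid of classes need not be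
  cancellative, so equality of differences in the completion holds only up to an auxiliary summand.
  Independence of representatives therefore arises at two levels: for triples within a class, and
  for pairs of classes within a difference.\<close>

abbreviation diff_class :: "('a, 'b) monoid_scheme \<Rightarrow> 'a \<Rightarrow> 'a \<Rightarrow> ('a \<times> 'a) set" where
  "diff_class M a b \<equiv> completion_rel M `` {(a, b)}"

context comm_monoid
begin

lemma equiv_completion_rel: "equiv (carrier G \<times> carrier G) (completion_rel G)"
proof (rule equivI)
  show "completion_rel G \<subseteq> (carrier G \<times> carrier G) \<times> (carrier G \<times> carrier G)"
    by (auto simp: completion_rel_def)
  show "refl_on (carrier G \<times> carrier G) (completion_rel G)"
    by (rule refl_onI) (auto simp: completion_rel_def)
  show "sym (completion_rel G)"
    by (rule symI) (auto simp: completion_rel_def intro: sym)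
  show "trans (completion_rel G)"
  proof (rule transI, clarify)
    fix a b c d e f
    assume "((a, b), (c, d)) \<in> completion_rel G" "((c, d), (e, f)) \<in> completion_rel G"
    then obtain k l where
      carr: "a \<in> carrier G" "b \<in> carrier G" "c \<in> carrier G" "d \<in> carrier G" "e \<in> carrier G"
        "f \<in> carrier G" "k \<in> carrier G" "l \<in> carrier G"
      and k: "a \<otimes> d \<otimes> k = c \<otimes> b \<otimes> k" and l: "c \<otimes> f \<otimes> l = e \<otimes> d \<otimes> l"
      unfolding completion_rel_def by auto
    \<comment> \<open>Without cancellation the middle element \<open>d\<close> cannot be removed, so
      it joins the two given witnesses in the new witness
      \<open>d \<otimes> k \<otimes> l\<close>.\<close>
    have "a \<otimes> f \<otimes> (d \<otimes> k \<otimes> l) = (a \<otimes> d \<otimes> k) \<otimes> (f \<otimes> l)" using carr by (simp add: m_ac)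
    also have "\<dots> = (c \<otimes> f \<otimes> l) \<otimes> (b \<otimes> k)" unfolding k using carr by (simp add: m_ac)
    also have "\<dots> = e \<otimes> b \<otimes> (d \<otimes> k \<otimes> l)" unfolding l using carr by (simp add: m_ac)
    finally have "a \<otimes> f \<otimes> (d \<otimes> k \<otimes> l) = e \<otimes> b \<otimes> (d \<otimes> k \<otimes> l)" .
    with carr show "((a, b), (e, f)) \<in> completion_rel G"
      unfolding completion_rel_def by (auto intro: bexI[of _ "d \<otimes> k \<otimes> l"])
  qed
qed

lemma diff_class_eq_iff:
  assumes "a \<in> carrier G" "b \<in> carrier G" "c \<in> carrier G" "d \<in> carrier G"
  shows "diff_class G a b = diff_class G c d \<longleftrightarrow>
    (\<exists>k \<in> carrier G. a \<otimes> d \<otimes> k = c \<otimes> b \<otimes> k)"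
  using assms eq_equiv_class_iff[OF equiv_completion_rel, of "(a, b)" "(c, d)"]
  by (simp add: completion_rel_def)

lemma diff_classI:
  assumes "a \<in> carrier G" "b \<in> carrier G" "c \<in> carrier G" "d \<in> carrier G"
    and "a \<otimes> d = c \<otimes> b"
  shows "diff_class G a b = diff_class G c d"
  using assms by (auto simp: diff_class_eq_iff intro: bexI[of _ \<one>])

lemma diff_class_self:
  "\<lbrakk>a \<in> carrier G; b \<in> carrier G\<rbrakk> \<Longrightarrow> (a, b) \<in> diff_class G a b"
  by (rule equiv_class_self[OF equiv_completion_rel]) simp

lemma diff_class_memD:
  assumes "(c, d) \<in> diff_class G a b"
  shows "a \<in> carrier G" "b \<in> carrier G" "c \<in> carrier G" "d \<in> carrier G"
    and "diff_class G c d = diff_class G a b"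
  using assms equiv_class_eq[OF equiv_completion_rel, of "(a, b)" "(c, d)"]
  by (auto simp: completion_rel_def)

lemma diff_class_in:
  "\<lbrakk>a \<in> carrier G; b \<in> carrier G\<rbrakk> \<Longrightarrow> diff_class G a b \<in> carrier (group_completion G)"
  by (auto simp: group_completion_def intro: quotientI)

lemma group_completion_cases:
  assumes "P \<in> carrier (group_completion G)"
  obtains a b where "a \<in> carrier G" "b \<in> carrier G" "P = diff_class G a b"
  using assms unfolding group_completion_def by (auto elim!: quotientE)

text \<open>The product is defined as a union over all pairs of representatives. Multiplying the two
  witnesses shows that all classes in this union coincide; since the index sets are nonempty, the
  union is that common class. Operations on classes of triples and induced maps are computed by the
  same pattern below.\<close>

lemma mult_diff_class:
  assumes carr: "a \<in> carrier G" "b \<in> carrier G" "c \<in> carrier G" "d \<in> carrier G"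
  shows "diff_class G a b \<otimes>\<^bsub>group_completion G\<^esub> diff_class G c d = diff_class G (a \<otimes> c) (b \<otimes> d)"
proof -
  have eq: "diff_class G (a' \<otimes> c') (b' \<otimes> d') = diff_class G (a \<otimes> c) (b \<otimes> d)"
    if 1: "(a', b') \<in> diff_class G a b" and 2: "(c', d') \<in> diff_class G c d" for a' b' c' d'
  proof -
    note carr' = diff_class_memD(3,4)[OF 1] diff_class_memD(3,4)[OF 2]
    obtain k l where kl: "k \<in> carrier G" "l \<in> carrier G"
      and k: "a' \<otimes> b \<otimes> k = a \<otimes> b' \<otimes> k" and l: "c' \<otimes> d \<otimes> l = c \<otimes> d' \<otimes> l"
      using diff_class_memD(5)[OF 1] diff_class_memD(5)[OF 2] carr carr'
      by (auto simp: diff_class_eq_iff)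
    have "(a' \<otimes> c') \<otimes> (b \<otimes> d) \<otimes> (k \<otimes> l) = (a' \<otimes> b \<otimes> k) \<otimes> (c' \<otimes> d \<otimes> l)"
      using carr carr' kl by (simp add: m_ac)
    also have "\<dots> = (a \<otimes> c) \<otimes> (b' \<otimes> d') \<otimes> (k \<otimes> l)"
      unfolding k l using carr carr' kl by (simp add: m_ac)
    finally show ?thesis
      using carr carr' kl by (subst diff_class_eq_iff) (auto intro!: bexI[of _ "k \<otimes> l"])
  qed
  have ne: "diff_class G a b \<noteq> {}" "diff_class G c d \<noteq> {}"
    using diff_class_self carr by blast+
  show ?thesis
    unfolding group_completion_def monoid.simps
    by (intro SUP_eq_const ne; clarify; intro SUP_eq_const ne; clarify; rule eq; simp)
qed

lemma one_group_completion: "\<one>\<^bsub>group_completion G\<^esub> = diff_class G \<one> \<one>"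
  by (simp add: group_completion_def)

lemma comm_group_group_completion: "comm_group (group_completion G)"
proof (rule comm_groupI)
  show "\<exists>y \<in> carrier (group_completion G). y \<otimes>\<^bsub>group_completion G\<^esub> x = \<one>\<^bsub>group_completion G\<^esub>"
    if "x \<in> carrier (group_completion G)" for x
    using that
  proof (rule group_completion_cases)
    fix a b assume *: "a \<in> carrier G" "b \<in> carrier G" "x = diff_class G a b"
    then have "diff_class G (b \<otimes> a) (a \<otimes> b) = diff_class G \<one> \<one>"
      by (intro diff_classI) (auto simp: m_ac)
    with * have "diff_class G b a \<otimes>\<^bsub>group_completion G\<^esub> x = \<one>\<^bsub>group_completion G\<^esub>"
      by (simp add: mult_diff_class one_group_completion)
    with * diff_class_in show ?thesis by blast
  qed
qed (auto elim!: group_completion_cases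
      simp: mult_diff_class one_group_completion diff_class_in m_ac)

lemma inv_diff_class:
  assumes "a \<in> carrier G" "b \<in> carrier G"
  shows "inv\<^bsub>group_completion G\<^esub> diff_class G a b = diff_class G b a"
proof -
  interpret K: comm_group "group_completion G" by (rule comm_group_group_completion)
  have "diff_class G (b \<otimes> a) (a \<otimes> b) = diff_class G \<one> \<one>"
    using assms by (intro diff_classI) (auto simp: m_ac)
  with assms show ?thesis
    by (intro K.inv_equality) (auto simp: mult_diff_class one_group_completion diff_class_in)
qed

text \<open>Links the form in which \<open>tau_alpha\<close> presents an element, as an embedded
  class times an inverse, with the normal form \<open>diff_class\<close> used for all
  computations.\<close>

lemma completion_embed_mult_inv:
  assumes "a \<in> carrier G" "b \<in> carrier G"
  shows "completion_embed G a \<otimes>\<^bsub>group_completion G\<^esub>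
    inv\<^bsub>group_completion G\<^esub> completion_embed G b = diff_class G a b"
  using assms by (simp add: completion_embed_def inv_diff_class mult_diff_class)

lemma completion_embed_in:
  "a \<in> carrier G \<Longrightarrow> completion_embed G a \<in> carrier (group_completion G)"
  by (simp add: completion_embed_def diff_class_in)

text \<open>Groups are cancellative, so the auxiliary factor \<open>k\<close> drops out once
  \<open>v\<close> is applied. This is the universal property of the completion, at the level of
  representatives.\<close>

lemma hom_diff_well_defined:
  assumes A: "comm_group A" and v: "v \<in> hom G A"
    and carr: "a \<in> carrier G" "b \<in> carrier G" "c \<in> carrier G" "d \<in> carrier G"
    and eq: "diff_class G a b = diff_class G c d"
  shows "v a \<otimes>\<^bsub>A\<^esub> inv\<^bsub>A\<^esub> v b = v c \<otimes>\<^bsub>A\<^esub> inv\<^bsub>A\<^esub> v d"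
proof -
  interpret A: comm_group A by (rule A)
  have vin: "x \<in> carrier G \<Longrightarrow> v x \<in> carrier A" for x using v by (auto simp: hom_def)
  obtain k where k: "k \<in> carrier G" "a \<otimes> d \<otimes> k = c \<otimes> b \<otimes> k"
    using eq carr by (auto simp: diff_class_eq_iff)
  then have "v a \<otimes>\<^bsub>A\<^esub> v d \<otimes>\<^bsub>A\<^esub> v k = v c \<otimes>\<^bsub>A\<^esub> v b \<otimes>\<^bsub>A\<^esub> v k"
    using carr hom_mult[OF v] by (metis m_closed)
  then have eq': "v a \<otimes>\<^bsub>A\<^esub> v d = v c \<otimes>\<^bsub>A\<^esub> v b" using carr k vin by simp
  have "v a = v c \<otimes>\<^bsub>A\<^esub> v b \<otimes>\<^bsub>A\<^esub> inv\<^bsub>A\<^esub> v d"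
    using A.inv_solve_right[of "v a" "v c \<otimes>\<^bsub>A\<^esub> v b" "v d"] eq' carr vin by simp
  also have "\<dots> = v c \<otimes>\<^bsub>A\<^esub> inv\<^bsub>A\<^esub> v d \<otimes>\<^bsub>A\<^esub> v b" using carr vin by (simp add: A.m_ac)
  finally show ?thesis
    using A.inv_solve_right'[of "v c \<otimes>\<^bsub>A\<^esub> inv\<^bsub>A\<^esub> v d" "v a" "v b"] carr vin by simp
qed

text \<open>The image \<open>f k\<close> of a witness is again a witness, so every representative of
  the difference contributes the same class to the union.\<close>

lemma completion_map_diff_class:
  assumes N: "comm_monoid N" and f: "f \<in> hom G N"
    and carr: "a \<in> carrier G" "b \<in> carrier G"
  shows "completion_map N f (diff_class G a b) = diff_class N (f a) (f b)"
proof -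
  interpret N: comm_monoid N by (rule N)
  have fin: "x \<in> carrier G \<Longrightarrow> f x \<in> carrier N" for x using f by (auto simp: hom_def)
  have eq: "diff_class N (f c) (f d) = diff_class N (f a) (f b)"
    if "(c, d) \<in> diff_class G a b" for c d
  proof -
    note cd = diff_class_memD[OF that]
    obtain k where k: "k \<in> carrier G" "c \<otimes> b \<otimes> k = a \<otimes> d \<otimes> k"
      using cd carr by (auto simp: diff_class_eq_iff)
    then have "f c \<otimes>\<^bsub>N\<^esub> f b \<otimes>\<^bsub>N\<^esub> f k = f a \<otimes>\<^bsub>N\<^esub> f d \<otimes>\<^bsub>N\<^esub> f k"
      using cd carr hom_mult[OF f] by (metis m_closed)
    then show ?thesis using cd carr k fin by (subst N.diff_class_eq_iff) auto
  qed
  have ne: "diff_class G a b \<noteq> {}" using diff_class_self[OF carr] by blast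
  show ?thesis
    unfolding completion_map_def by (intro SUP_eq_const ne; clarify; rule eq; simp)
qed

end

lemma completion_map_hom:
  assumes M: "comm_monoid M" and N: "comm_monoid N" and f: "f \<in> hom M N"
  shows "completion_map N f \<in> hom (group_completion M) (group_completion N)"
proof -
  interpret M: comm_monoid M by (rule M)
  interpret N: comm_monoid N by (rule N)
  have fin: "x \<in> carrier M \<Longrightarrow> f x \<in> carrier N" for x using f by (auto simp: hom_def)
  show ?thesis
    by (rule homI)
      (auto elim!: M.group_completion_cases
        simp: M.mult_diff_class N.mult_diff_class M.completion_map_diff_class[OF N f]
          N.diff_class_in fin hom_mult[OF f])
qed

section \<open>Chosen coproducts and additive functors\<close>

lemma HomD:
  assumes "f \<in> Hom C X Y"
  shows "f \<in> Arr C" "Dom C f = X" "Cod C f = Y"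
  using assms by (auto simp: Hom_def)

lemma (in category) Hom_Ob: "f \<in> Hom C X Y \<Longrightarrow> X \<in> Ob C \<and> Y \<in> Ob C"
  using Dom_in Cod_in by (auto simp: Hom_def)

lemma Iso_Hom: "f \<in> Iso C X Y \<Longrightarrow> f \<in> Hom C X Y"
  by (simp add: Iso_def)

lemma Hom_coproduct_smcat [simp]: "Hom (coproduct_smcat B) X Y = Hom B X Y"
  by (simp add: Hom_def coproduct_smcat_def)

context coproduct_category
begin

lemma
  assumes "f \<in> Hom B X Z" "g \<in> Hom B Y Z"
  shows copair_in: "copair B f g \<in> Hom B (X \<uplus> Y) Z"
    and copair_inj1: "copair B f g \<cdot> inj1 B X Y = f"
    and copair_inj2: "copair B f g \<cdot> inj2 B X Y = g"
  using theI'[OF cop_universal[OF assms]] HomD[OF assms(1)] HomD[OF assms(2)]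
  by (auto simp: copair_def)

lemma copair_eqI:
  assumes "k \<in> Hom B (X \<uplus> Y) Z" "k \<cdot> inj1 B X Y = f" "k \<cdot> inj2 B X Y = g"
    and "f \<in> Hom B X Z" "g \<in> Hom B Y Z"
  shows "copair B f g = k"
  using cop_universal[OF assms(4,5)] copair_in copair_inj1 copair_inj2 assms by metis

lemma comp_copair:
  assumes f: "f \<in> Hom B X Z" and g: "g \<in> Hom B Y Z" and k: "k \<in> Hom B Z W"
  shows "k \<cdot> copair B f g = copair B (k \<cdot> f) (k \<cdot> g)"
proof -
  have ob: "X \<in> Ob B" "Y \<in> Ob B" using f g Hom_Ob by blast+
  have 1: "k \<cdot> copair B f g \<cdot> inj1 B X Y = k \<cdot> f"
    using Comp_assoc[OF inj1_in[OF ob] copair_in[OF f g] k] by (simp add: copair_inj1[OF f g])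
  have 2: "k \<cdot> copair B f g \<cdot> inj2 B X Y = k \<cdot> g"
    using Comp_assoc[OF inj2_in[OF ob] copair_in[OF f g] k] by (simp add: copair_inj2[OF f g])
  show ?thesis
    by (rule copair_eqI[symmetric, OF Comp_in[OF copair_in[OF f g] k] 1 2 Comp_in[OF f k] Comp_in[OF g k]])
qed

lemma from_init_in: "X \<in> Ob B \<Longrightarrow> from_init B X \<in> Hom B (init B) X"
  unfolding from_init_def by (rule theI'[OF init_universal])

lemma init_eq: "\<lbrakk>f \<in> Hom B (init B) X; g \<in> Hom B (init B) X\<rbrakk> \<Longrightarrow> f = g"
  using init_universal[of X] Hom_Ob by blast

end

context additive_functor
begin

lemma FA_in_carrier:
  "\<lbrakk>f \<in> Hom B X Y; x \<in> carrier (FO H X)\<rbrakk> \<Longrightarrow> FA H f x \<in> carrier (FO H Y)"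
  using FA_hom by (auto simp: hom_def)

lemma FA_copair:
  assumes f: "f \<in> Hom B X Z" and g: "g \<in> Hom B Y Z"
    and x: "x \<in> carrier (FO H X)" and y: "y \<in> carrier (FO H Y)"
  shows "FA H (copair B f g) (FA H (inj1 B X Y) x \<otimes>\<^bsub>FO H (X \<uplus> Y)\<^esub> FA H (inj2 B X Y) y)
    = FA H f x \<otimes>\<^bsub>FO H Z\<^esub> FA H g y"
proof -
  have ob: "X \<in> Ob B" "Y \<in> Ob B" using f g Hom_Ob by blast+
  note i = inj1_in[OF ob] and j = inj2_in[OF ob] and c = copair_in[OF f g]
  show ?thesis
    using hom_mult[OF FA_hom[OF c] FA_in_carrier[OF i x] FA_in_carrier[OF j y]]
      FA_Comp[OF i c x] FA_Comp[OF j c y] copair_inj1[OF f g] copair_inj2[OF f g] by simp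
qed

text \<open>The two injections of the initial object into its double agree, so all pairs \<open>(x, x\<inverse>)\<close>
  lie in the kernel of the additivity isomorphism.\<close>

lemma FO_init_trivial:
  assumes x: "x \<in> carrier (FO H (init B))"
  shows "x = \<one>\<^bsub>FO H (init B)\<^esub>"
proof -
  let ?I = "init B"
  let ?J = "?I \<uplus> ?I"
  let ?m = "\<lambda>(x, y). FA H (inj1 B ?I ?I) x \<otimes>\<^bsub>FO H ?J\<^esub> FA H (inj2 B ?I ?I) y"
  interpret G: comm_group "FO H ?I" by (rule FO_group[OF init_in])
  interpret J: comm_group "FO H ?J" by (rule FO_group[OF cop_in[OF init_in init_in]])
  note i = inj1_in[OF init_in init_in]
  have eq: "inj2 B ?I ?I = inj1 B ?I ?I"
    by (rule init_eq[OF inj2_in[OF init_in init_in] i])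
  interpret h: group_hom "FO H ?I" "FO H ?J" "FA H (inj1 B ?I ?I)"
    by unfold_locales (rule FA_hom[OF i])
  have "inj_on ?m (carrier (FO H ?I \<times>\<times> FO H ?I))"
    using additive[OF init_in init_in] by (simp add: iso_def bij_betw_def)
  moreover have "?m (x, inv\<^bsub>FO H ?I\<^esub> x) = ?m (\<one>\<^bsub>FO H ?I\<^esub>, \<one>\<^bsub>FO H ?I\<^esub>)"
    using x by (simp add: eq)
  moreover have "(x, inv\<^bsub>FO H ?I\<^esub> x) \<in> carrier (FO H ?I \<times>\<times> FO H ?I)"
    "(\<one>\<^bsub>FO H ?I\<^esub>, \<one>\<^bsub>FO H ?I\<^esub>) \<in> carrier (FO H ?I \<times>\<times> FO H ?I)"
    using x by (simp_all add: DirProd_def)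
  ultimately have "(x, inv\<^bsub>FO H ?I\<^esub> x) = (\<one>\<^bsub>FO H ?I\<^esub>, \<one>\<^bsub>FO H ?I\<^esub>)"
    by (rule inj_onD)
  then show ?thesis by simp
qed

end

section \<open>The relative Grothendieck group\<close>

text \<open>The results are needed for three choices of \<open>T\<close>: the given functor, the
  identity of \<open>B\<close>, and \<open>S\<close>. Keeping \<open>T\<close> a parameter makes the
  two special cases interpretations, and the scheme type of \<open>Ct\<close> admits
  \<open>B\<close> and \<open>Cs\<close> themselves, with their additional structure, in its
  place.\<close>

locale cospan_invariant =
  fixes B :: "('ob, 'mb) cpcat"
    and Cs :: "('os, 'ms) smcat"
    and Ct :: "('ot, 'mt, 'z) cat_scheme"
    and S :: "('os, 'ms, 'ob, 'mb) fun_data"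
    and T :: "('ot, 'mt, 'ob, 'mb) fun_data"
    and H :: "('ob, 'mb, 'g monoid, 'g \<Rightarrow> 'g) fun_data"
    and \<alpha> :: "'os \<Rightarrow> 'g"
  assumes Cs: "symmetric_monoidal_category Cs"
    and S: "strict_monoidal_functor Cs (coproduct_smcat B) S"
    and T: "cat_functor Ct B T"
    and H: "additive_functor B H"
    and \<alpha>: "additive_invariant Cs B S H \<alpha>"
begin

sublocale H: additive_functor B H by (rule H)
sublocale Cs: symmetric_monoidal_category Cs by (rule Cs)
sublocale T: cat_functor Ct B T by (rule T)
sublocale S: strict_monoidal_functor Cs "coproduct_smcat B" S by (rule S)
sublocale additive_invariant Cs B S H \<alpha> by (rule \<alpha>)

text \<open>In contrast to \<open>alpha_triples\<close>, it requires \<open>X\<close> to be an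
  object of \<open>Ct\<close>, so that \<open>FO T X\<close> lies in \<open>B\<close>, and it omits
  the repeated middle component.\<close>

definition triple :: "'os \<Rightarrow> 'ot \<Rightarrow> 'mb \<Rightarrow> bool" where
  "triple V X h \<longleftrightarrow> V \<in> Ob Cs \<and> X \<in> Ob Ct \<and> h \<in> Hom B (FO S V) (FO T X)"

abbreviation "cls V X h \<equiv> alpha_class Cs B S H \<alpha> T (V, X, h)"
abbreviation "M X \<equiv> alpha_monoid Cs B S H \<alpha> T X"
abbreviation "K \<equiv> K_alpha Cs B S H \<alpha> Ct T"

lemma tripleD:
  assumes "triple V X h"
  shows "V \<in> Ob Cs" "X \<in> Ob Ct" "h \<in> Hom B (FO S V) (FO T X)"
  using assms by (auto simp: triple_def)

section \<open>Strict monoidality of \<open>S\<close>, expressed through the coproducts of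
  \<open>B\<close>\<close>

lemma S_Ob: "V \<in> Ob Cs \<Longrightarrow> FO S V \<in> Ob B"
  using S.FO_in by (simp add: coproduct_smcat_def)

lemma S_Hom: "f \<in> Hom Cs V W \<Longrightarrow> FA S f \<in> Hom B (FO S V) (FO S W)"
  using S.FA_in by simp

lemma S_Ide: "V \<in> Ob Cs \<Longrightarrow> FA S (Ide Cs V) = Ide B (FO S V)"
  using S.FA_Ide by (simp add: coproduct_smcat_def)

lemma S_Comp:
  "\<lbrakk>f \<in> Hom Cs U V; g \<in> Hom Cs V W\<rbrakk> \<Longrightarrow> FA S (g \<cdot>\<^bsub>Cs\<^esub> f) = FA S g \<cdot>\<^bsub>B\<^esub> FA S f"
  using S.FA_Comp by (simp add: coproduct_smcat_def)

lemma S_tens: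
  "\<lbrakk>V \<in> Ob Cs; W \<in> Ob Cs\<rbrakk> \<Longrightarrow> FO S (V \<boxplus>\<^bsub>Cs\<^esub> W) = FO S V \<uplus>\<^bsub>B\<^esub> FO S W"
  using S.FO_tens by (simp add: coproduct_smcat_def)

lemma S_munit: "FO S (munit Cs) = init B"
  using S.FO_munit by (simp add: coproduct_smcat_def)

lemma S_tensA:
  assumes "f \<in> Hom Cs V V'" "g \<in> Hom Cs W W'"
  shows "FA S (f \<oplus>\<^bsub>Cs\<^esub> g) = copair B
    (inj1 B (FO S V') (FO S W') \<cdot>\<^bsub>B\<^esub> FA S f) (inj2 B (FO S V') (FO S W') \<cdot>\<^bsub>B\<^esub> FA S g)"
  using S.FA_tensA[of f g] HomD[OF assms(1)] HomD[OF assms(2)]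
    HomD(3)[OF S_Hom[OF assms(1)]] HomD(3)[OF S_Hom[OF assms(2)]]
  by (simp add: coproduct_smcat_def)

lemma Iso_tensA:
  assumes f: "f \<in> Iso Cs V V'" and g: "g \<in> Iso Cs W W'"
  shows "f \<oplus>\<^bsub>Cs\<^esub> g \<in> Iso Cs (V \<boxplus>\<^bsub>Cs\<^esub> W) (V' \<boxplus>\<^bsub>Cs\<^esub> W')"
proof -
  obtain f' g' where *: "f \<in> Hom Cs V V'" "g \<in> Hom Cs W W'" "f' \<in> Hom Cs V' V" "g' \<in> Hom Cs W' W"
    "f' \<cdot>\<^bsub>Cs\<^esub> f = Ide Cs V" "f \<cdot>\<^bsub>Cs\<^esub> f' = Ide Cs V'"
    "g' \<cdot>\<^bsub>Cs\<^esub> g = Ide Cs W" "g \<cdot>\<^bsub>Cs\<^esub> g' = Ide Cs W'"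
    using f g by (auto simp: Iso_def)
  then have ob: "V \<in> Ob Cs" "V' \<in> Ob Cs" "W \<in> Ob Cs" "W' \<in> Ob Cs" using Cs.Hom_Ob by blast+
  show ?thesis
    unfolding Iso_def using * ob Cs.tensA_in
    by (auto intro!: bexI[of _ "f' \<oplus>\<^bsub>Cs\<^esub> g'"]
        simp: Cs.tensA_Comp[symmetric, of f V V' f' V g W W' g' W]
          Cs.tensA_Comp[symmetric, of f' V' V f V' g' W' W g W'] Cs.tensA_Ide)
qed

lemma FA_value_in:
  "\<lbrakk>V \<in> Ob Cs; h \<in> Hom B (FO S V) Z\<rbrakk> \<Longrightarrow> FA H h (\<alpha> V) \<in> carrier (FO H Z)"
  using H.FA_in_carrier value_in by blast

text \<open>This is where additivity of \<alpha> becomes additivity of the assignment sending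
  \<open>(V, h)\<close> to the pushed-forward value: \<open>value_tens\<close> presents the value at
  a sum through the two injections, and a copairing composed with them returns \<open>h\<close> and
  \<open>k\<close>.\<close>

lemma FA_copair_value:
  assumes "V \<in> Ob Cs" "W \<in> Ob Cs" "h \<in> Hom B (FO S V) Z" "k \<in> Hom B (FO S W) Z"
  shows "FA H (copair B h k) (\<alpha> (V \<boxplus>\<^bsub>Cs\<^esub> W)) = FA H h (\<alpha> V) \<otimes>\<^bsub>FO H Z\<^esub> FA H k (\<alpha> W)"
  using assms by (simp add: value_tens H.FA_copair value_in)

lemma copair_S_Hom:
  assumes "V \<in> Ob Cs" "W \<in> Ob Cs" "h \<in> Hom B (FO S V) Z" "k \<in> Hom B (FO S W) Z"
  shows "copair B h k \<in> Hom B (FO S (V \<boxplus>\<^bsub>Cs\<^esub> W)) Z"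
  using assms by (simp add: S_tens H.copair_in)

lemma S_Ide_Hom: "V \<in> Ob Cs \<Longrightarrow> Ide B (FO S V) \<in> Hom B (FO S V) (FO S V)"
  by (intro H.Ide_in S_Ob)

subsection \<open>The monoid of classes of triples\<close>

text \<open>The condition that \<alpha> is transported holds for identities and passes to inverses
  and composites because \<open>S\<close> and \<open>H\<close> are functorial; associativity in
  \<open>B\<close> does the same for the triangles over \<open>FO T X\<close>.\<close>

lemma equiv_alpha_iso: "equiv (alpha_triples Cs B S T X) (alpha_iso Cs B S H \<alpha> T X)"
proof (rule equivI)
  let ?r = "alpha_iso Cs B S H \<alpha> T X"
  show "?r \<subseteq> alpha_triples Cs B S T X \<times> alpha_triples Cs B S T X"
    by (auto simp: alpha_iso_def)
  have ide: "Ide Cs V \<in> Iso Cs V V" if "V \<in> Ob Cs" for V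
    using Cs.Ide_in[OF that] Cs.Comp_Ide[OF Cs.Ide_in[OF that]] by (auto simp: Iso_def)
  show "refl_on (alpha_triples Cs B S T X) ?r"
  proof (rule refl_onI, clarify)
    fix V Y h assume t: "(V, Y, h) \<in> alpha_triples Cs B S T X"
    then have "V \<in> Ob Cs" "h \<in> Hom B (FO S V) (FO T X)" by (auto simp: alpha_triples_def)
    then show "((V, Y, h), (V, Y, h)) \<in> ?r" using t ide[of V]
      by (auto simp: alpha_iso_def S_Ide H.Comp_Ide H.FA_Ide S_Ob value_in intro!: bexI[of _ "Ide Cs V"])
  qed
  show "sym ?r"
  proof (rule symI, clarify)
    fix V Y h V' Y' h' assume r: "((V, Y, h), (V', Y', h')) \<in> ?r"
    then obtain f g where f: "f \<in> Hom Cs V V'" "h' \<cdot>\<^bsub>B\<^esub> FA S f = h" "FA H (FA S f) (\<alpha> V) = \<alpha> V'"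
      and g: "g \<in> Hom Cs V' V" "g \<cdot>\<^bsub>Cs\<^esub> f = Ide Cs V" "f \<cdot>\<^bsub>Cs\<^esub> g = Ide Cs V'"
      and t: "(V, Y, h) \<in> alpha_triples Cs B S T X" "(V', Y', h') \<in> alpha_triples Cs B S T X"
      by (auto simp: alpha_iso_def Iso_def)
    have V: "V \<in> Ob Cs" "V' \<in> Ob Cs" and h': "h' \<in> Hom B (FO S V') (FO T X)"
      using t by (auto simp: alpha_triples_def)
    have "h \<cdot>\<^bsub>B\<^esub> FA S g = h' \<cdot>\<^bsub>B\<^esub> FA S (f \<cdot>\<^bsub>Cs\<^esub> g)"
      using H.Comp_assoc[OF S_Hom[OF g(1)] S_Hom[OF f(1)] h'] f g(1) by (simp add: S_Comp)
    then have 1: "h \<cdot>\<^bsub>B\<^esub> FA S g = h'" using g(3) V h' by (simp add: S_Ide H.Comp_Ide)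
    have "FA H (FA S g) (\<alpha> V') = FA H (FA S (g \<cdot>\<^bsub>Cs\<^esub> f)) (\<alpha> V)"
      using f g(1) H.FA_Comp[OF S_Hom[OF f(1)] S_Hom[OF g(1)] value_in[OF V(1)]] by (simp add: S_Comp)
    then have 2: "FA H (FA S g) (\<alpha> V') = \<alpha> V" using g(2) V by (simp add: S_Ide H.FA_Ide S_Ob value_in)
    have "g \<in> Iso Cs V' V" using f g by (auto simp: Iso_def)
    with t 1 2 show "((V', Y', h'), (V, Y, h)) \<in> ?r" by (auto simp: alpha_iso_def)
  qed
  show "trans ?r"
  proof (rule transI, clarify)
    fix V Y h V' Y' h' V'' Y'' h''
    assume "((V, Y, h), (V', Y', h')) \<in> ?r" "((V', Y', h'), (V'', Y'', h'')) \<in> ?r"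
    then obtain f g f' g' where
      f: "f \<in> Hom Cs V V'" "h' \<cdot>\<^bsub>B\<^esub> FA S f = h" "FA H (FA S f) (\<alpha> V) = \<alpha> V'"
      and g: "g \<in> Hom Cs V' V''" "h'' \<cdot>\<^bsub>B\<^esub> FA S g = h'" "FA H (FA S g) (\<alpha> V') = \<alpha> V''"
      and f': "f' \<in> Hom Cs V' V" "f' \<cdot>\<^bsub>Cs\<^esub> f = Ide Cs V" "f \<cdot>\<^bsub>Cs\<^esub> f' = Ide Cs V'"
      and g': "g' \<in> Hom Cs V'' V'" "g' \<cdot>\<^bsub>Cs\<^esub> g = Ide Cs V'" "g \<cdot>\<^bsub>Cs\<^esub> g' = Ide Cs V''"
      and t: "(V, Y, h) \<in> alpha_triples Cs B S T X" "(V'', Y'', h'') \<in> alpha_triples Cs B S T X"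
      by (auto simp: alpha_iso_def Iso_def)
    have V: "V \<in> Ob Cs" and h'': "h'' \<in> Hom B (FO S V'') (FO T X)"
      using t by (auto simp: alpha_triples_def)
    have "(f' \<cdot>\<^bsub>Cs\<^esub> g') \<cdot>\<^bsub>Cs\<^esub> (g \<cdot>\<^bsub>Cs\<^esub> f) = Ide Cs V"
      using Cs.Comp_assoc[OF Cs.Comp_in[OF f(1) g(1)] g'(1) f'(1)] Cs.Comp_assoc[OF f(1) g(1) g'(1)]
        f' g' f Cs.Ide_Comp by simp
    moreover have "(g \<cdot>\<^bsub>Cs\<^esub> f) \<cdot>\<^bsub>Cs\<^esub> (f' \<cdot>\<^bsub>Cs\<^esub> g') = Ide Cs V''"
      using Cs.Comp_assoc[OF Cs.Comp_in[OF g'(1) f'(1)] f(1) g(1)] Cs.Comp_assoc[OF g'(1) f'(1) f(1)]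
        f' g' f Cs.Ide_Comp by simp
    ultimately have "g \<cdot>\<^bsub>Cs\<^esub> f \<in> Iso Cs V V''"
      using Cs.Comp_in[OF f(1) g(1)] Cs.Comp_in[OF g'(1) f'(1)] by (auto simp: Iso_def)
    moreover have "h'' \<cdot>\<^bsub>B\<^esub> FA S (g \<cdot>\<^bsub>Cs\<^esub> f) = h"
      using H.Comp_assoc[OF S_Hom[OF f(1)] S_Hom[OF g(1)] h''] f g by (simp add: S_Comp)
    moreover have "FA H (FA S (g \<cdot>\<^bsub>Cs\<^esub> f)) (\<alpha> V) = \<alpha> V''"
      using f g H.FA_Comp[OF S_Hom[OF f(1)] S_Hom[OF g(1)] value_in[OF V]] by (simp add: S_Comp)
    ultimately show "((V, Y, h), (V'', Y'', h'')) \<in> ?r" using t by (auto simp: alpha_iso_def)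
  qed
qed

lemma cls_eqI:
  assumes "triple V X h" "triple W X k" and f: "f \<in> Iso Cs V W"
    and "k \<cdot>\<^bsub>B\<^esub> FA S f = h" "FA H (FA S f) (\<alpha> V) = \<alpha> W"
  shows "cls V X h = cls W X k"
  unfolding alpha_class_def prod.case using assms
  by (intro equiv_class_eq[OF equiv_alpha_iso]) (auto simp: alpha_iso_def alpha_triples_def triple_def)

lemma cls_self: "triple V X h \<Longrightarrow> (V, X, h) \<in> cls V X h"
  unfolding alpha_class_def prod.case
  by (rule equiv_class_self[OF equiv_alpha_iso]) (auto simp: alpha_triples_def triple_def)

lemma cls_mem:
  assumes "(W, Y, k) \<in> cls V X h" "triple V X h"
  obtains f where "Y = X" "triple W X k" "f \<in> Iso Cs V W" "k \<cdot>\<^bsub>B\<^esub> FA S f = h"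
    "FA H (FA S f) (\<alpha> V) = \<alpha> W"
  using assms by (auto simp: alpha_class_def alpha_iso_def alpha_triples_def triple_def)

lemma cls_in: "triple V X h \<Longrightarrow> cls V X h \<in> carrier (M X)"
  by (auto simp: alpha_monoid_def alpha_class_def alpha_triples_def triple_def intro!: quotientI)

lemma M_cases:
  assumes "P \<in> carrier (M X)" "X \<in> Ob Ct"
  obtains V h where "triple V X h" "P = cls V X h"
  using assms by (auto simp: alpha_monoid_def alpha_class_def alpha_triples_def triple_def elim!: quotientE)

lemma triple_copair:
  "\<lbrakk>triple V X h; triple W X k\<rbrakk> \<Longrightarrow> triple (V \<boxplus>\<^bsub>Cs\<^esub> W) X (copair B h k)"
  by (auto simp: triple_def Cs.tens_in copair_S_Hom)

text \<open>If \<open>f\<close> and \<open>g\<close> are \<alpha>-isomorphisms, so is their tensor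
  product: by strictness its image under \<open>S\<close> is a copairing of injections composed with
  \<open>FA S f\<close> and \<open>FA S g\<close>, which matches both the induced arrows and, by
  additivity, the values of \<alpha>. Hence the union defining the product contains a single
  class.\<close>

lemma mult_cls:
  assumes h: "triple V X h" and k: "triple W X k"
  shows "cls V X h \<otimes>\<^bsub>M X\<^esub> cls W X k = cls (V \<boxplus>\<^bsub>Cs\<^esub> W) X (copair B h k)"
proof -
  have eq: "cls (V' \<boxplus>\<^bsub>Cs\<^esub> W') X (copair B h' k') = cls (V \<boxplus>\<^bsub>Cs\<^esub> W) X (copair B h k)"
    if "(V', Y, h') \<in> cls V X h" "(W', Z, k') \<in> cls W X k" for V' Y h' W' Z k'
    using that(1) h
  proof (rule cls_mem)
    fix f assume f: "f \<in> Iso Cs V V'" "h' \<cdot>\<^bsub>B\<^esub> FA S f = h" "FA H (FA S f) (\<alpha> V) = \<alpha> V'"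
      and h': "triple V' X h'"
    show ?thesis using that(2) k
    proof (rule cls_mem)
      fix g assume g: "g \<in> Iso Cs W W'" "k' \<cdot>\<^bsub>B\<^esub> FA S g = k" "FA H (FA S g) (\<alpha> W) = \<alpha> W'"
        and k': "triple W' X k'"
      note Sf = S_Hom[OF Iso_Hom[OF f(1)]] and Sg = S_Hom[OF Iso_Hom[OF g(1)]]
      have V: "V \<in> Ob Cs" and W: "W \<in> Ob Cs" using h k by (auto dest: tripleD)
      have i: "inj1 B (FO S V') (FO S W') \<in> Hom B (FO S V') (FO S V' \<uplus>\<^bsub>B\<^esub> FO S W')"
        and j: "inj2 B (FO S V') (FO S W') \<in> Hom B (FO S W') (FO S V' \<uplus>\<^bsub>B\<^esub> FO S W')"
        using h' k' by (auto simp: triple_def intro!: H.inj1_in H.inj2_in S_Ob)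
      have h2: "h' \<in> Hom B (FO S V') (FO T X)" and k2: "k' \<in> Hom B (FO S W') (FO T X)"
        using h' k' by (auto dest: tripleD)
      note c = H.copair_in[OF h2 k2]
      note eqS = S_tensA[OF Iso_Hom[OF f(1)] Iso_Hom[OF g(1)]]
      have "copair B h' k' \<cdot>\<^bsub>B\<^esub> FA S (f \<oplus>\<^bsub>Cs\<^esub> g) = copair B h k"
        unfolding eqS H.comp_copair[OF H.Comp_in[OF Sf i] H.Comp_in[OF Sg j] c]
        using H.Comp_assoc[OF Sf i c] H.Comp_assoc[OF Sg j c] f g
        by (simp add: H.copair_inj1[OF h2 k2] H.copair_inj2[OF h2 k2])
      moreover have "FA H (FA S (f \<oplus>\<^bsub>Cs\<^esub> g)) (\<alpha> (V \<boxplus>\<^bsub>Cs\<^esub> W)) = \<alpha> (V' \<boxplus>\<^bsub>Cs\<^esub> W')"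
        unfolding eqS FA_copair_value[OF V W H.Comp_in[OF Sf i] H.Comp_in[OF Sg j]]
        using tripleD(1)[OF h'] tripleD(1)[OF k'] f g
        by (simp add: H.FA_Comp[OF Sf i value_in[OF V]] H.FA_Comp[OF Sg j value_in[OF W]]
            value_tens S_tens)
      ultimately show ?thesis
        using Iso_tensA[OF f(1) g(1)] h k h' k'
        by (intro cls_eqI[symmetric] triple_copair) auto
    qed
  qed
  have ne: "cls V X h \<noteq> {}" "cls W X k \<noteq> {}" using cls_self h k by blast+
  show ?thesis
    unfolding alpha_monoid_def monoid.simps
    by (intro SUP_eq_const ne; clarify; intro SUP_eq_const ne; clarify; rule eq; simp)
qed

section \<open>The monoid laws, from the constraint isomorphisms of \<open>Cs\<close>\<close>

lemma triple_one: "X \<in> Ob Ct \<Longrightarrow> triple (munit Cs) X (from_init B (FO T X))"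
  by (simp add: triple_def Cs.munit_in S_munit H.from_init_in T.FO_in)

lemma one_M: "\<one>\<^bsub>M X\<^esub> = cls (munit Cs) X (from_init B (FO T X))"
  by (simp add: alpha_monoid_def)

text \<open>Since \<open>S\<close> sends the unit to the initial object, the value of \<alpha> there
  lies in a trivial group, and homomorphisms preserve the neutral element.\<close>

lemma FA_value_munit:
  assumes "h \<in> Hom B (init B) Z"
  shows "FA H h (\<alpha> (munit Cs)) = \<one>\<^bsub>FO H Z\<^esub>"
proof -
  have "Z \<in> Ob B" using assms H.Hom_Ob by blast
  interpret G: comm_group "FO H (init B)" by (rule H.FO_group[OF H.init_in])
  interpret G': comm_group "FO H Z" by (rule H.FO_group) fact
  interpret h: group_hom "FO H (init B)" "FO H Z" "FA H h"
    by unfold_locales (rule H.FA_hom[OF assms])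
  have "\<alpha> (munit Cs) = \<one>\<^bsub>FO H (init B)\<^esub>"
    using value_in[OF Cs.munit_in] by (intro H.FO_init_trivial) (simp add: S_munit)
  then show ?thesis by simp
qed

text \<open>The associator of \<open>Cs\<close> is an \<alpha>-isomorphism: \<open>S\<close> sends
  it to the associator of coproducts, which rebrackets copairings, and both values of \<alpha>
  expand to one product of three injected values, up to bracketing.\<close>

lemma cls_assoc:
  assumes "triple U X h" "triple V X k" "triple W X l"
  shows "cls ((U \<boxplus>\<^bsub>Cs\<^esub> V) \<boxplus>\<^bsub>Cs\<^esub> W) X (copair B (copair B h k) l)
    = cls (U \<boxplus>\<^bsub>Cs\<^esub> (V \<boxplus>\<^bsub>Cs\<^esub> W)) X (copair B h (copair B k l))"
proof (rule cls_eqI)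
  let ?U = "FO S U" and ?V = "FO S V" and ?W = "FO S W" and ?X = "FO T X"
  let ?VW = "?V \<uplus>\<^bsub>B\<^esub> ?W"
  have t: "U \<in> Ob Cs" "V \<in> Ob Cs" "W \<in> Ob Cs"
    and h: "h \<in> Hom B ?U ?X" and k: "k \<in> Hom B ?V ?X" and l: "l \<in> Hom B ?W ?X"
    using assms by (auto dest: tripleD)
  note ob = S_Ob[OF t(1)] S_Ob[OF t(2)] S_Ob[OF t(3)]
  note obVW = H.cop_in[OF ob(2,3)]
  note i = H.inj1_in[OF ob(1) obVW] and j = H.inj2_in[OF ob(1) obVW]
  note i' = H.inj1_in[OF ob(2,3)] and j' = H.inj2_in[OF ob(2,3)]
  note ji' = H.Comp_in[OF i' j] and jj' = H.Comp_in[OF j' j]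
  note c = H.copair_in[OF h H.copair_in[OF k l]]
  have S: "FA S (massoc Cs U V W) =
    copair B (copair B (inj1 B ?U ?VW) (inj2 B ?U ?VW \<cdot>\<^bsub>B\<^esub> inj1 B ?V ?W))
      (inj2 B ?U ?VW \<cdot>\<^bsub>B\<^esub> inj2 B ?V ?W)"
    using S.FA_massoc[OF t] by (simp add: coproduct_smcat_def)
  show "copair B h (copair B k l) \<cdot>\<^bsub>B\<^esub> FA S (massoc Cs U V W) = copair B (copair B h k) l"
    unfolding S H.comp_copair[OF H.copair_in[OF i ji'] jj' c] H.comp_copair[OF i ji' c]
    using H.Comp_assoc[OF i' j c] H.Comp_assoc[OF j' j c]
    by (simp add: H.copair_inj1[OF h H.copair_in[OF k l]] H.copair_inj2[OF h H.copair_in[OF k l]]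
        H.copair_inj1[OF k l] H.copair_inj2[OF k l])
  interpret G: comm_group "FO H (?U \<uplus>\<^bsub>B\<^esub> ?VW)" by (rule H.FO_group[OF H.cop_in[OF ob(1) obVW]])
  \<comment> \<open>On the right-bracketed side the value at \<open>V\<close> and \<open>W\<close>
    sits inside the second injection. Expanding it and using that \<open>FA H\<close> of this
    injection is a homomorphism makes the injections the composites that occur in the
    associator.\<close>
  have "FA H (inj2 B ?U ?VW) (\<alpha> (V \<boxplus>\<^bsub>Cs\<^esub> W)) =
      FA H (inj2 B ?U ?VW \<cdot>\<^bsub>B\<^esub> inj1 B ?V ?W) (\<alpha> V) \<otimes>\<^bsub>FO H (?U \<uplus>\<^bsub>B\<^esub> ?VW)\<^esub>
      FA H (inj2 B ?U ?VW \<cdot>\<^bsub>B\<^esub> inj2 B ?V ?W) (\<alpha> W)"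
    using t hom_mult[OF H.FA_hom[OF j] FA_value_in[OF _ i'] FA_value_in[OF _ j']]
    by (simp add: value_tens H.FA_Comp[OF i' j] H.FA_Comp[OF j' j] value_in)
  then show "FA H (FA S (massoc Cs U V W)) (\<alpha> ((U \<boxplus>\<^bsub>Cs\<^esub> V) \<boxplus>\<^bsub>Cs\<^esub> W))
    = \<alpha> (U \<boxplus>\<^bsub>Cs\<^esub> (V \<boxplus>\<^bsub>Cs\<^esub> W))"
    unfolding S
      FA_copair_value[OF Cs.tens_in[OF t(1,2)] t(3) copair_S_Hom[OF t(1,2) i ji'] jj']
      FA_copair_value[OF t(1,2) i ji']
    using t FA_value_in[OF t(1) i] FA_value_in[OF t(2) ji'] FA_value_in[OF t(3) jj']
    by (simp add: value_tens[OF t(1) Cs.tens_in[OF t(2,3)]] S_tens G.m_assoc)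
  show "massoc Cs U V W \<in> Iso Cs (U \<boxplus>\<^bsub>Cs\<^esub> V \<boxplus>\<^bsub>Cs\<^esub> W) (U \<boxplus>\<^bsub>Cs\<^esub> (V \<boxplus>\<^bsub>Cs\<^esub> W))"
    by (rule Cs.massoc_iso[OF t])
qed (simp_all add: assms triple_copair)

text \<open>The witness is the symmetry, which exchanges the two injections. Its effect on \<alpha>
  is to swap two factors, which is harmless in an abelian group.\<close>

lemma cls_commute:
  assumes "triple V X h" "triple W X k"
  shows "cls (V \<boxplus>\<^bsub>Cs\<^esub> W) X (copair B h k) = cls (W \<boxplus>\<^bsub>Cs\<^esub> V) X (copair B k h)"
proof (rule cls_eqI)
  let ?V = "FO S V" and ?W = "FO S W" and ?X = "FO T X"
  have t: "V \<in> Ob Cs" "W \<in> Ob Cs" and h: "h \<in> Hom B ?V ?X" and k: "k \<in> Hom B ?W ?X"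
    using assms by (auto dest: tripleD)
  note ob = S_Ob[OF t(1)] S_Ob[OF t(2)]
  note i = H.inj1_in[OF ob(2,1)] and j = H.inj2_in[OF ob(2,1)]
  have S: "FA S (braid Cs V W) = copair B (inj2 B ?W ?V) (inj1 B ?W ?V)"
    using S.FA_braid[OF t] by (simp add: coproduct_smcat_def)
  show "copair B k h \<cdot>\<^bsub>B\<^esub> FA S (braid Cs V W) = copair B h k"
    unfolding S H.comp_copair[OF j i H.copair_in[OF k h]]
    by (simp add: H.copair_inj1[OF k h] H.copair_inj2[OF k h])
  interpret G: comm_group "FO H (?W \<uplus>\<^bsub>B\<^esub> ?V)" by (rule H.FO_group[OF H.cop_in[OF ob(2,1)]])
  show "FA H (FA S (braid Cs V W)) (\<alpha> (V \<boxplus>\<^bsub>Cs\<^esub> W)) = \<alpha> (W \<boxplus>\<^bsub>Cs\<^esub> V)"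
    unfolding S FA_copair_value[OF t j i] value_tens[OF t(2,1)]
    using FA_value_in[OF t(1) j] FA_value_in[OF t(2) i] by (rule G.m_comm)
  show "braid Cs V W \<in> Iso Cs (V \<boxplus>\<^bsub>Cs\<^esub> W) (W \<boxplus>\<^bsub>Cs\<^esub> V)" by (rule Cs.braid_iso[OF t])
qed (simp_all add: assms triple_copair)

text \<open>The witness is the left unit constraint. The arrows match because a morphism out of the
  initial object is unique; the values match because the unit contributes a neutral factor.\<close>

lemma cls_one_left:
  assumes "triple V X h"
  shows "cls (munit Cs \<boxplus>\<^bsub>Cs\<^esub> V) X (copair B (from_init B (FO T X)) h) = cls V X h"
proof (rule cls_eqI)
  let ?V = "FO S V" and ?X = "FO T X"
  have V: "V \<in> Ob Cs" and h: "h \<in> Hom B ?V ?X" using assms by (auto dest: tripleD)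
  have X: "?X \<in> Ob B" using h H.Hom_Ob by blast
  note f = H.from_init_in[OF S_Ob[OF V]] and e = S_Ide_Hom[OF V]
  have S: "FA S (lunit Cs V) = copair B (from_init B ?V) (Ide B ?V)"
    using S.FA_lunit[OF V] by (simp add: coproduct_smcat_def)
  show "h \<cdot>\<^bsub>B\<^esub> FA S (lunit Cs V) = copair B (from_init B ?X) h"
    unfolding S H.comp_copair[OF f e h] H.Comp_Ide[OF h]
      H.init_eq[OF H.Comp_in[OF f h] H.from_init_in[OF X]] ..
  interpret G: comm_group "FO H ?V" by (rule H.FO_group[OF S_Ob[OF V]])
  show "FA H (FA S (lunit Cs V)) (\<alpha> (munit Cs \<boxplus>\<^bsub>Cs\<^esub> V)) = \<alpha> V"
    unfolding S using V f e value_in[OF V]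
    by (simp add: FA_copair_value[OF Cs.munit_in V] S_munit FA_value_munit H.FA_Ide S_Ob)
  show "lunit Cs V \<in> Iso Cs (munit Cs \<boxplus>\<^bsub>Cs\<^esub> V) V" by (rule Cs.lunit_iso[OF V])
  show "triple (munit Cs \<boxplus>\<^bsub>Cs\<^esub> V) X (copair B (from_init B ?X) h)"
    using assms triple_one by (auto intro: triple_copair dest: tripleD)
qed (rule assms)

lemma comm_monoid_M:
  assumes X: "X \<in> Ob Ct"
  shows "comm_monoid (M X)"
proof (rule comm_monoidI)
  show "P \<otimes>\<^bsub>M X\<^esub> Q = Q \<otimes>\<^bsub>M X\<^esub> P" if P: "P \<in> carrier (M X)" and Q: "Q \<in> carrier (M X)" for P Q
    using M_cases[OF P X] M_cases[OF Q X] cls_commute by (metis mult_cls)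
qed (use X in \<open>auto elim!: M_cases simp: one_M mult_cls triple_copair triple_one cls_in
      cls_assoc cls_one_left\<close>)

subsection \<open>Functoriality\<close>

abbreviation "push \<equiv> alpha_push Cs B S H \<alpha> Ct T"

lemma triple_comp:
  "\<lbrakk>triple V X h; f \<in> Hom Ct X Y\<rbrakk> \<Longrightarrow> triple V Y (FA T f \<cdot>\<^bsub>B\<^esub> h)"
  unfolding triple_def using T.FA_in H.Comp_in T.C.Hom_Ob by blast

text \<open>An \<alpha>-isomorphism over \<open>FO T X\<close> remains one after composition with
  \<open>FA T f\<close>, since the condition on \<alpha> does not involve the target.\<close>

lemma push_cls:
  assumes h: "triple V X h" and f: "f \<in> Hom Ct X Y"
  shows "push f (cls V X h) = cls V Y (FA T f \<cdot>\<^bsub>B\<^esub> h)"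
proof -
  have eq: "cls W Y (FA T f \<cdot>\<^bsub>B\<^esub> k) = cls V Y (FA T f \<cdot>\<^bsub>B\<^esub> h)"
    if "(W, Z, k) \<in> cls V X h" for W Z k
    using that h
  proof (rule cls_mem)
    fix g assume k: "triple W X k" and g: "g \<in> Iso Cs V W" "k \<cdot>\<^bsub>B\<^esub> FA S g = h"
      "FA H (FA S g) (\<alpha> V) = \<alpha> W"
    have "(FA T f \<cdot>\<^bsub>B\<^esub> k) \<cdot>\<^bsub>B\<^esub> FA S g = FA T f \<cdot>\<^bsub>B\<^esub> h"
      using H.Comp_assoc[OF S_Hom[OF Iso_Hom[OF g(1)]] tripleD(3)[OF k] T.FA_in[OF f]] g(2) by simp
    then show ?thesis
      using g triple_comp[OF k f] triple_comp[OF h f] by (intro cls_eqI[symmetric]) auto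
  qed
  have ne: "cls V X h \<noteq> {}" using cls_self h by blast
  show ?thesis
    unfolding alpha_push_def HomD(3)[OF f] by (intro SUP_eq_const ne; clarify; rule eq; simp)
qed

lemma push_hom:
  assumes f: "f \<in> Hom Ct X Y"
  shows "push f \<in> hom (M X) (M Y)"
proof -
  have X: "X \<in> Ob Ct" using f T.C.Hom_Ob by blast
  show ?thesis
  proof (rule homI)
    fix P assume "P \<in> carrier (M X)"
    then show "push f P \<in> carrier (M Y)"
      using X
    proof (rule M_cases)
      fix V h assume h: "triple V X h" "P = cls V X h"
      show "push f P \<in> carrier (M Y)"
        unfolding h(2) push_cls[OF h(1) f] by (rule cls_in[OF triple_comp[OF h(1) f]])
    qed
  next
    fix P Q assume "P \<in> carrier (M X)" "Q \<in> carrier (M X)"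
    then obtain V h W k where h: "triple V X h" "P = cls V X h" and k: "triple W X k" "Q = cls W X k"
      using X by (metis M_cases)
    have "FA T f \<cdot>\<^bsub>B\<^esub> copair B h k = copair B (FA T f \<cdot>\<^bsub>B\<^esub> h) (FA T f \<cdot>\<^bsub>B\<^esub> k)"
      using h k by (auto intro!: H.comp_copair[OF _ _ T.FA_in[OF f]] dest: tripleD)
    then show "push f (P \<otimes>\<^bsub>M X\<^esub> Q) = push f P \<otimes>\<^bsub>M Y\<^esub> push f Q"
      by (simp only: h k mult_cls[OF h(1) k(1)] push_cls[OF triple_copair[OF h(1) k(1)] f]
          push_cls[OF h(1) f] push_cls[OF k(1) f]
          mult_cls[OF triple_comp[OF h(1) f] triple_comp[OF k(1) f]])
  qed
qed

lemma carrier_K_cases: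
  assumes "P \<in> carrier (FO K X)" "X \<in> Ob Ct"
  obtains V h W k where "triple V X h" "triple W X k"
    "P = diff_class (M X) (cls V X h) (cls W X k)"
  using assms comm_monoid.group_completion_cases[OF comm_monoid_M] M_cases
  unfolding K_alpha_def fun_data.simps by metis

lemma FA_K_diff_class:
  assumes h: "triple V X h" and k: "triple W X k" and f: "f \<in> Hom Ct X Y"
  shows "FA K f (diff_class (M X) (cls V X h) (cls W X k))
    = diff_class (M Y) (cls V Y (FA T f \<cdot>\<^bsub>B\<^esub> h)) (cls W Y (FA T f \<cdot>\<^bsub>B\<^esub> k))"
proof -
  have ob: "X \<in> Ob Ct" "Y \<in> Ob Ct" using f T.C.Hom_Ob by blast+
  show ?thesis
    unfolding K_alpha_def fun_data.simps HomD(3)[OF f]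
      comm_monoid.completion_map_diff_class[OF comm_monoid_M[OF ob(1)] comm_monoid_M[OF ob(2)]
        push_hom[OF f] cls_in[OF h] cls_in[OF k]]
      push_cls[OF h f] push_cls[OF k f] ..
qed

lemma ab_functor_K: "ab_functor Ct K"
proof (intro ab_functor.intro ab_functor_axioms.intro T.C.category_axioms)
  show "comm_group (FO K X)" if "X \<in> Ob Ct" for X
    using comm_monoid.comm_group_group_completion[OF comm_monoid_M[OF that]] by (simp add: K_alpha_def)
  show "FA K f \<in> hom (FO K X) (FO K Y)" if f: "f \<in> Hom Ct X Y" for f X Y
    using completion_map_hom[OF comm_monoid_M comm_monoid_M push_hom[OF f]] T.C.Hom_Ob[OF f] HomD[OF f]
    by (simp add: K_alpha_def)
  show "FA K (Ide Ct X) P = P" if X: "X \<in> Ob Ct" and P: "P \<in> carrier (FO K X)" for X P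
    using P X
  proof (rule carrier_K_cases)
    fix V h W k assume *: "triple V X h" "triple W X k" "P = diff_class (M X) (cls V X h) (cls W X k)"
    then show ?thesis
      using H.Ide_Comp[OF tripleD(3)[OF *(1)]] H.Ide_Comp[OF tripleD(3)[OF *(2)]]
      by (simp add: FA_K_diff_class[OF _ _ T.C.Ide_in[OF X]] T.FA_Ide[OF X])
  qed
  show "FA K (g \<cdot>\<^bsub>Ct\<^esub> f) P = FA K g (FA K f P)"
    if f: "f \<in> Hom Ct X Y" and g: "g \<in> Hom Ct Y Z" and P: "P \<in> carrier (FO K X)" for f g X Y Z P
    using P T.C.Hom_Ob[OF f, THEN conjunct1]
  proof (rule carrier_K_cases)
    fix V h W k assume *: "triple V X h" "triple W X k" "P = diff_class (M X) (cls V X h) (cls W X k)"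
    have "(FA T g \<cdot>\<^bsub>B\<^esub> FA T f) \<cdot>\<^bsub>B\<^esub> h = FA T g \<cdot>\<^bsub>B\<^esub> (FA T f \<cdot>\<^bsub>B\<^esub> h)"
      "(FA T g \<cdot>\<^bsub>B\<^esub> FA T f) \<cdot>\<^bsub>B\<^esub> k = FA T g \<cdot>\<^bsub>B\<^esub> (FA T f \<cdot>\<^bsub>B\<^esub> k)"
      using * H.Comp_assoc[OF tripleD(3) T.FA_in[OF f] T.FA_in[OF g]] by blast+
    then show ?thesis
      unfolding *(3) FA_K_diff_class[OF *(1,2) f] FA_K_diff_class[OF *(1,2) T.C.Comp_in[OF f g]]
        FA_K_diff_class[OF triple_comp[OF *(1) f] triple_comp[OF *(2) f] g] T.FA_Comp[OF f g]
      by simp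
  qed
qed

lemma ab_functor_HT: "ab_functor Ct (comp_fun H T)"
proof (intro ab_functor.intro ab_functor_axioms.intro T.C.category_axioms)
  show "comm_group (FO (comp_fun H T) X)" if "X \<in> Ob Ct" for X
    using H.FO_group T.FO_in[OF that] by (simp add: comp_fun_def)
  show "FA (comp_fun H T) f \<in> hom (FO (comp_fun H T) X) (FO (comp_fun H T) Y)"
    if "f \<in> Hom Ct X Y" for f X Y
    using H.FA_hom T.FA_in[OF that] by (simp add: comp_fun_def)
  show "FA (comp_fun H T) (Ide Ct X) x = x" if "X \<in> Ob Ct" "x \<in> carrier (FO (comp_fun H T) X)" for X x
    using that H.FA_Ide T.FO_in T.FA_Ide by (simp add: comp_fun_def)
  show "FA (comp_fun H T) (g \<cdot>\<^bsub>Ct\<^esub> f) x = FA (comp_fun H T) g (FA (comp_fun H T) f x)"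
    if "f \<in> Hom Ct X Y" "g \<in> Hom Ct Y Z" "x \<in> carrier (FO (comp_fun H T) X)" for f g X Y Z x
    using that H.FA_Comp[OF T.FA_in[OF that(1)] T.FA_in[OF that(2)]] T.FA_Comp[OF that(1,2)]
    by (simp add: comp_fun_def)
qed

subsection \<open>The natural transformation\<close>

text \<open>A function on classes is needed so that \<open>hom_diff_well_defined\<close> applies.
  One such function serves all \<open>X\<close>, because the target is carried by the arrow
  \<open>h\<close>.\<close>

definition class_value :: "('os \<times> 'ot \<times> 'mb) set \<Rightarrow> 'g" where
  "class_value P = (THE a. \<exists>(V, X, h) \<in> P. a = FA H h (\<alpha> V))"

text \<open>Here the \<alpha>-condition on isomorphisms is decisive: if \<open>h\<close> factors as
  \<open>k\<close> after \<open>FA S f\<close>, then pushing \<alpha> at \<open>V\<close> along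
  \<open>h\<close> first reaches \<alpha> at \<open>W\<close> and then continues along
  \<open>k\<close>.\<close>

lemma class_value_cls:
  assumes h: "triple V X h"
  shows "class_value (cls V X h) = FA H h (\<alpha> V)"
proof -
  have eq: "FA H k (\<alpha> W) = FA H h (\<alpha> V)" if "(W, Y, k) \<in> cls V X h" for W Y k
    using that h
  proof (rule cls_mem)
    fix f assume k: "triple W X k" and f: "f \<in> Iso Cs V W" "k \<cdot>\<^bsub>B\<^esub> FA S f = h"
      "FA H (FA S f) (\<alpha> V) = \<alpha> W"
    have "FA H (k \<cdot>\<^bsub>B\<^esub> FA S f) (\<alpha> V) = FA H k (FA H (FA S f) (\<alpha> V))"
      using H.FA_Comp[OF S_Hom[OF Iso_Hom[OF f(1)]] tripleD(3)[OF k] value_in[OF tripleD(1)[OF h]]] .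
    with f show ?thesis by simp
  qed
  show ?thesis
    unfolding class_value_def using eq cls_self[OF h] by (intro the_equality) blast+
qed

lemma class_value_hom:
  assumes X: "X \<in> Ob Ct"
  shows "class_value \<in> hom (M X) (FO H (FO T X))"
proof (rule homI)
  fix P assume "P \<in> carrier (M X)"
  then show "class_value P \<in> carrier (FO H (FO T X))"
    using X by (rule M_cases) (simp add: class_value_cls FA_value_in[OF tripleD(1) tripleD(3)])
next
  fix P Q assume "P \<in> carrier (M X)" "Q \<in> carrier (M X)"
  then obtain V h W k where h: "triple V X h" "P = cls V X h" and k: "triple W X k" "Q = cls W X k"
    using X by (metis M_cases)
  then show "class_value (P \<otimes>\<^bsub>M X\<^esub> Q) = class_value P \<otimes>\<^bsub>FO H (FO T X)\<^esub> class_value Q"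
    by (simp add: mult_cls class_value_cls triple_copair FA_copair_value tripleD)
qed

abbreviation "\<tau> \<equiv> tau_alpha Cs B S H \<alpha> Ct T"

lemma K_class_mult_inv:
  assumes "triple V X h" "triple W X k"
  shows "K_class Cs B S H \<alpha> T (V, X, h) \<otimes>\<^bsub>FO K X\<^esub> inv\<^bsub>FO K X\<^esub> K_class Cs B S H \<alpha> T (W, X, k)
    = diff_class (M X) (cls V X h) (cls W X k)"
  using assms comm_monoid.completion_embed_mult_inv[OF comm_monoid_M[OF tripleD(2)] cls_in cls_in]
  by (simp add: K_class_def K_alpha_def)

text \<open>Evaluates the definite description in \<open>tau_alpha\<close>: the given pair of
  triples shows that a value exists, and extending \<open>class_value\<close> to differences shows
  that every other presentation yields the same one.\<close>

lemma tau_diff_class: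
  assumes h: "triple V X h" and k: "triple W X k"
  shows "\<tau> X (diff_class (M X) (cls V X h) (cls W X k))
    = FA H h (\<alpha> V) \<otimes>\<^bsub>FO H (FO T X)\<^esub> inv\<^bsub>FO H (FO T X)\<^esub> FA H k (\<alpha> W)"
proof -
  have X: "X \<in> Ob Ct" by (rule tripleD(2)[OF h])
  interpret MX: comm_monoid "M X" by (rule comm_monoid_M[OF X])
  have well_defined: "FA H h' (\<alpha> V') \<otimes>\<^bsub>FO H (FO T X)\<^esub> inv\<^bsub>FO H (FO T X)\<^esub> FA H k' (\<alpha> W')
      = FA H h (\<alpha> V) \<otimes>\<^bsub>FO H (FO T X)\<^esub> inv\<^bsub>FO H (FO T X)\<^esub> FA H k (\<alpha> W)"
    if h': "triple V' X h'" and k': "triple W' X k'" and eq: "diff_class (M X) (cls V' X h') (cls W' X k')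
      = diff_class (M X) (cls V X h) (cls W X k)" for V' h' W' k'
    using MX.hom_diff_well_defined[OF H.FO_group[OF T.FO_in[OF X]] class_value_hom[OF X]
        cls_in[OF h'] cls_in[OF k'] cls_in[OF h] cls_in[OF k] eq]
    by (simp only: class_value_cls[OF h] class_value_cls[OF k] class_value_cls[OF h'] class_value_cls[OF k'])
  have triple: "(V', X, h') \<in> alpha_triples Cs B S T X \<longleftrightarrow> triple V' X h'" for V' h'
    using X by (auto simp: alpha_triples_def triple_def)
  show ?thesis
    unfolding tau_alpha_def triple
  proof (rule the_equality)
    show "\<exists>V' h' W' k'. triple V' X h' \<and> triple W' X k' \<and>
      diff_class (M X) (cls V X h) (cls W X k) = K_class Cs B S H \<alpha> T (V', X, h') \<otimes>\<^bsub>FO K X\<^esub>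
        inv\<^bsub>FO K X\<^esub> K_class Cs B S H \<alpha> T (W', X, k') \<and>
      FA H h (\<alpha> V) \<otimes>\<^bsub>FO H (FO T X)\<^esub> inv\<^bsub>FO H (FO T X)\<^esub> FA H k (\<alpha> W)
        = FA H h' (\<alpha> V') \<otimes>\<^bsub>FO H (FO T X)\<^esub> inv\<^bsub>FO H (FO T X)\<^esub> FA H k' (\<alpha> W')"
      using K_class_mult_inv[OF h k] h k by metis
  next
    fix a assume "\<exists>V' h' W' k'. triple V' X h' \<and> triple W' X k' \<and>
      diff_class (M X) (cls V X h) (cls W X k) = K_class Cs B S H \<alpha> T (V', X, h') \<otimes>\<^bsub>FO K X\<^esub>
        inv\<^bsub>FO K X\<^esub> K_class Cs B S H \<alpha> T (W', X, k') \<and>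
      a = FA H h' (\<alpha> V') \<otimes>\<^bsub>FO H (FO T X)\<^esub> inv\<^bsub>FO H (FO T X)\<^esub> FA H k' (\<alpha> W')"
    then obtain V' h' W' k' where *: "triple V' X h'" "triple W' X k'"
      "diff_class (M X) (cls V X h) (cls W X k) = K_class Cs B S H \<alpha> T (V', X, h') \<otimes>\<^bsub>FO K X\<^esub>
        inv\<^bsub>FO K X\<^esub> K_class Cs B S H \<alpha> T (W', X, k')"
      "a = FA H h' (\<alpha> V') \<otimes>\<^bsub>FO H (FO T X)\<^esub> inv\<^bsub>FO H (FO T X)\<^esub> FA H k' (\<alpha> W')"
      by blast
    show "a = FA H h (\<alpha> V) \<otimes>\<^bsub>FO H (FO T X)\<^esub> inv\<^bsub>FO H (FO T X)\<^esub> FA H k (\<alpha> W)"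
      unfolding *(4) using *(3) by (intro well_defined *(1,2)) (simp only: K_class_mult_inv[OF *(1,2)])
  qed
qed

text \<open>Embedding a class means subtracting the unit class, whose value is neutral.\<close>

lemma tau_K_class:
  assumes h: "triple V X h"
  shows "\<tau> X (K_class Cs B S H \<alpha> T (V, X, h)) = FA H h (\<alpha> V)"
proof -
  have X: "X \<in> Ob Ct" by (rule tripleD(2)[OF h])
  interpret G: comm_group "FO H (FO T X)" by (rule H.FO_group[OF T.FO_in[OF X]])
  have "FA H (from_init B (FO T X)) (\<alpha> (munit Cs)) = \<one>\<^bsub>FO H (FO T X)\<^esub>"
    by (rule FA_value_munit[OF H.from_init_in[OF T.FO_in[OF X]]])
  then show ?thesis
    using tau_diff_class[OF h triple_one[OF X]] h
    by (simp add: K_class_def completion_embed_def one_M FA_value_in[OF tripleD(1,3)])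
qed

lemma ab_nat_trans_tau: "ab_nat_trans Ct K (comp_fun H T) \<tau>"
proof (intro ab_nat_trans.intro ab_nat_trans_axioms.intro ab_functor_K ab_functor_HT)
  fix X assume X: "X \<in> Ob Ct"
  interpret MX: comm_monoid "M X" by (rule comm_monoid_M[OF X])
  interpret G: comm_group "FO H (FO T X)" by (rule H.FO_group[OF T.FO_in[OF X]])
  show "\<tau> X \<in> hom (FO K X) (FO (comp_fun H T) X)"
  proof (rule homI)
    fix P assume "P \<in> carrier (FO K X)"
    then show "\<tau> X P \<in> carrier (FO (comp_fun H T) X)"
      using X by (rule carrier_K_cases) (simp add: tau_diff_class comp_fun_def FA_value_in[OF tripleD(1,3)])
  next
    fix P Q assume "P \<in> carrier (FO K X)" "Q \<in> carrier (FO K X)"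
    then obtain V h W k V' h' W' k' where
      P: "triple V X h" "triple W X k" "P = diff_class (M X) (cls V X h) (cls W X k)"
      and Q: "triple V' X h'" "triple W' X k'" "Q = diff_class (M X) (cls V' X h') (cls W' X k')"
      using X by (metis carrier_K_cases)
    \<comment> \<open>Differences multiply componentwise, so both components become classes of
      copairings, on which \<open>FA_copair_value\<close> splits the value.\<close>
    have "P \<otimes>\<^bsub>FO K X\<^esub> Q = diff_class (M X) (cls (V \<boxplus>\<^bsub>Cs\<^esub> V') X (copair B h h'))
        (cls (W \<boxplus>\<^bsub>Cs\<^esub> W') X (copair B k k'))"
      unfolding K_alpha_def fun_data.simps P(3) Q(3)
        MX.mult_diff_class[OF cls_in[OF P(1)] cls_in[OF P(2)] cls_in[OF Q(1)] cls_in[OF Q(2)]]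
        mult_cls[OF P(1) Q(1)] mult_cls[OF P(2) Q(2)] ..
    then have "\<tau> X (P \<otimes>\<^bsub>FO K X\<^esub> Q) =
        (FA H h (\<alpha> V) \<otimes>\<^bsub>FO H (FO T X)\<^esub> FA H h' (\<alpha> V')) \<otimes>\<^bsub>FO H (FO T X)\<^esub>
        inv\<^bsub>FO H (FO T X)\<^esub> (FA H k (\<alpha> W) \<otimes>\<^bsub>FO H (FO T X)\<^esub> FA H k' (\<alpha> W'))"
      using tau_diff_class[OF triple_copair[OF P(1) Q(1)] triple_copair[OF P(2) Q(2)]]
        FA_copair_value[OF tripleD(1)[OF P(1)] tripleD(1)[OF Q(1)] tripleD(3)[OF P(1)] tripleD(3)[OF Q(1)]]
        FA_copair_value[OF tripleD(1)[OF P(2)] tripleD(1)[OF Q(2)] tripleD(3)[OF P(2)] tripleD(3)[OF Q(2)]]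
      by simp
    then show "\<tau> X (P \<otimes>\<^bsub>FO K X\<^esub> Q) = \<tau> X P \<otimes>\<^bsub>FO (comp_fun H T) X\<^esub> \<tau> X Q"
      using P Q tau_diff_class[OF P(1,2)] tau_diff_class[OF Q(1,2)]
      by (simp add: comp_fun_def FA_value_in[OF tripleD(1,3)] G.inv_mult G.m_ac)
  qed
next
  fix f X Y P assume f: "f \<in> Hom Ct X Y" and P: "P \<in> carrier (FO K X)"
  have ob: "X \<in> Ob Ct" "Y \<in> Ob Ct" using T.C.Hom_Ob[OF f] by auto
  interpret GX: comm_group "FO H (FO T X)" by (rule H.FO_group[OF T.FO_in[OF ob(1)]])
  interpret GY: comm_group "FO H (FO T Y)" by (rule H.FO_group[OF T.FO_in[OF ob(2)]])
  interpret f: group_hom "FO H (FO T X)" "FO H (FO T Y)" "FA H (FA T f)"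
    by unfold_locales (rule H.FA_hom[OF T.FA_in[OF f]])
  from P ob(1) show "\<tau> Y (FA K f P) = FA (comp_fun H T) f (\<tau> X P)"
  proof (rule carrier_K_cases)
    fix V h W k
    assume *: "triple V X h" "triple W X k" "P = diff_class (M X) (cls V X h) (cls W X k)"
    \<comment> \<open>On single classes naturality is functoriality of \<open>H\<close>; it passes
      to differences because \<open>FA H (FA T f)\<close> is a group homomorphism.\<close>
    have "FA H (FA T f \<cdot>\<^bsub>B\<^esub> h) (\<alpha> V) = FA H (FA T f) (FA H h (\<alpha> V))"
      "FA H (FA T f \<cdot>\<^bsub>B\<^esub> k) (\<alpha> W) = FA H (FA T f) (FA H k (\<alpha> W))"
      using * H.FA_Comp[OF tripleD(3) T.FA_in[OF f] value_in[OF tripleD(1)]] by blast+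
    then show ?thesis
      using * unfolding *(3) FA_K_diff_class[OF *(1,2) f] tau_diff_class[OF *(1,2)]
        tau_diff_class[OF triple_comp[OF *(1) f] triple_comp[OF *(2) f]]
      by (simp add: comp_fun_def FA_value_in[OF tripleD(1,3)])
  qed
qed

section \<open>Uniqueness of the natural transformation\<close>

lemma K_class_in: "triple V X h \<Longrightarrow> K_class Cs B S H \<alpha> T (V, X, h) \<in> carrier (FO K X)"
  using comm_monoid.completion_embed_in[OF comm_monoid_M[OF tripleD(2)] cls_in] by (simp add: K_class_def K_alpha_def)

lemma FA_K_class:
  assumes h: "triple V X h" and f: "f \<in> Hom Ct X Y"
  shows "FA K f (K_class Cs B S H \<alpha> T (V, X, h)) = K_class Cs B S H \<alpha> T (V, Y, FA T f \<cdot>\<^bsub>B\<^esub> h)"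
proof -
  have X: "X \<in> Ob Ct" "Y \<in> Ob Ct" using T.C.Hom_Ob[OF f] by auto
  \<comment> \<open>The subtracted unit triple must be pushed to the unit triple over
    \<open>Y\<close>; initiality ensures this.\<close>
  have "FA T f \<cdot>\<^bsub>B\<^esub> from_init B (FO T X) = from_init B (FO T Y)"
    using X T.FO_in by (intro H.init_eq[OF H.Comp_in[OF _ T.FA_in[OF f]]] H.from_init_in)
  then show ?thesis
    using FA_K_diff_class[OF h triple_one[OF X(1)] f]
    by (simp add: K_class_def completion_embed_def one_M)
qed

text \<open>Each component of \<sigma> is a group homomorphism and every element is a quotient of
  two embedded classes, so agreement on single triples is enough.\<close>

lemma ab_nat_trans_eq_tau:
  assumes \<sigma>: "ab_nat_trans Ct K (comp_fun H T) \<sigma>" and X: "X \<in> Ob Ct" and P: "P \<in> carrier (FO K X)"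
    and gen: "\<And>V h. triple V X h \<Longrightarrow> \<sigma> X (K_class Cs B S H \<alpha> T (V, X, h)) = FA H h (\<alpha> V)"
  shows "\<sigma> X P = \<tau> X P"
proof -
  interpret \<sigma>: ab_nat_trans Ct K "comp_fun H T" \<sigma> by (rule \<sigma>)
  interpret KX: comm_group "FO K X" by (rule \<sigma>.F.FO_group[OF X])
  interpret G: comm_group "FO (comp_fun H T) X" by (rule \<sigma>.G.FO_group[OF X])
  interpret s: group_hom "FO K X" "FO (comp_fun H T) X" "\<sigma> X"
    by unfold_locales (rule \<sigma>.component_hom[OF X])
  from P X show ?thesis
  proof (rule carrier_K_cases)
    fix V h W k
    assume *: "triple V X h" "triple W X k" "P = diff_class (M X) (cls V X h) (cls W X k)"
    show ?thesis
      unfolding *(3) tau_diff_class[OF *(1,2)] unfolding K_class_mult_inv[OF *(1,2), symmetric]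
      using K_class_in[OF *(1)] K_class_in[OF *(2)] gen[OF *(1)] gen[OF *(2)]
      by (simp add: comp_fun_def[of H T])
  qed
qed

text \<open>The argument is that of the Yoneda lemma, with the identity triple over \<open>Y\<close>
  as universal element. Requiring only \<open>FO T Y = FO S V\<close> lets one statement serve both
  cases.\<close>

lemma ab_nat_trans_K_class:
  assumes \<sigma>: "ab_nat_trans Ct K (comp_fun H T) \<sigma>" and V: "V \<in> Ob Cs" and f: "f \<in> Hom Ct Y X"
    and Y: "FO T Y = FO S V" and id: "\<sigma> Y (K_class Cs B S H \<alpha> T (V, Y, Ide B (FO S V))) = \<alpha> V"
  shows "\<sigma> X (K_class Cs B S H \<alpha> T (V, X, FA T f)) = FA H (FA T f) (\<alpha> V)"
proof -
  interpret \<sigma>: ab_nat_trans Ct K "comp_fun H T" \<sigma> by (rule \<sigma>)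
  have t: "triple V Y (Ide B (FO S V))" using V Y S_Ide_Hom T.C.Hom_Ob[OF f] by (simp add: triple_def)
  have "FA T f \<cdot>\<^bsub>B\<^esub> Ide B (FO S V) = FA T f"
    using H.Comp_Ide[OF T.FA_in[OF f]] Y by simp
  then show ?thesis
    using \<sigma>.natural[OF f K_class_in[OF t]] FA_K_class[OF t f] id by (simp add: comp_fun_def)
qed

end

section \<open>The transformation for general \<open>T\<close>, and its characterization for the
  identity and for \<open>S\<close>\<close>

theorem theorem1p3:
  fixes B :: "('ob, 'mb) cpcat"
    and Cs :: "('os, 'ms) smcat"
    and Ct :: "('ot, 'mt) cat"
    and S :: "('os, 'ms, 'ob, 'mb) fun_data"
    and T :: "('ot, 'mt, 'ob, 'mb) fun_data"
    and H :: "('ob, 'mb, 'g monoid, 'g \<Rightarrow> 'g) fun_data"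
    and \<alpha> :: "'os \<Rightarrow> 'g"
  assumes "coproduct_category B"
    and "symmetric_monoidal_category Cs"
    and "category Ct"
    and "strict_monoidal_functor Cs (coproduct_smcat B) S"
    and "cat_functor Ct B T"
    and "additive_functor B H"
    and "additive_invariant Cs B S H \<alpha>"
  shows
    "(ab_nat_trans Ct (K_alpha Cs B S H \<alpha> Ct T) (comp_fun H T) (tau_alpha Cs B S H \<alpha> Ct T) \<and>
      (\<forall>X \<in> Ob Ct. \<forall>V \<in> Ob Cs. \<forall>h \<in> Hom B (FO S V) (FO T X).
         tau_alpha Cs B S H \<alpha> Ct T X (K_class Cs B S H \<alpha> T (V, X, h)) = FA H h (\<alpha> V)))
   \<and>
     (full_functor B B id_fun \<longrightarrow>
        (ab_nat_trans B (K_alpha Cs B S H \<alpha> B id_fun) (comp_fun H id_fun)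
           (tau_alpha Cs B S H \<alpha> B id_fun) \<and>
         (\<forall>V \<in> Ob Cs. tau_alpha Cs B S H \<alpha> B id_fun (FO S V)
            (K_class Cs B S H \<alpha> id_fun (V, FO S V, Ide B (FO S V))) = \<alpha> V)) \<and>
        (\<forall>\<sigma>. ab_nat_trans B (K_alpha Cs B S H \<alpha> B id_fun) (comp_fun H id_fun) \<sigma> \<and>
           (\<forall>V \<in> Ob Cs. \<sigma> (FO S V)
              (K_class Cs B S H \<alpha> id_fun (V, FO S V, Ide B (FO S V))) = \<alpha> V)
           \<longrightarrow> (\<forall>X \<in> Ob B. \<forall>k \<in> carrier (FO (K_alpha Cs B S H \<alpha> B id_fun) X).
                 \<sigma> X k = tau_alpha Cs B S H \<alpha> B id_fun X k)))
   \<and>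
     (full_functor Cs B S \<longrightarrow>
        (ab_nat_trans Cs (K_alpha Cs B S H \<alpha> Cs S) (comp_fun H S)
           (tau_alpha Cs B S H \<alpha> Cs S) \<and>
         (\<forall>V \<in> Ob Cs. tau_alpha Cs B S H \<alpha> Cs S V
            (K_class Cs B S H \<alpha> S (V, V, Ide B (FO S V))) = \<alpha> V)) \<and>
        (\<forall>\<sigma>. ab_nat_trans Cs (K_alpha Cs B S H \<alpha> Cs S) (comp_fun H S) \<sigma> \<and>
           (\<forall>V \<in> Ob Cs. \<sigma> V (K_class Cs B S H \<alpha> S (V, V, Ide B (FO S V))) = \<alpha> V)
           \<longrightarrow> (\<forall>X \<in> Ob Cs. \<forall>k \<in> carrier (FO (K_alpha Cs B S H \<alpha> Cs S) X).
                 \<sigma> X k = tau_alpha Cs B S H \<alpha> Cs S X k)))"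
proof -
  interpret cospan_invariant B Cs Ct S T H \<alpha>
    using assms by (intro cospan_invariant.intro)
  have B: "category B" by (rule H.category_axioms)
  have id: "cat_functor B B id_fun"
    using B by (auto simp: cat_functor_def cat_functor_axioms_def id_fun_def)
  have id_simps [simp]: "FO id_fun Y = Y" "FA id_fun f = f" for Y :: 'ob and f :: 'mb
    by (simp_all add: id_fun_def)
  interpret I: cospan_invariant B Cs B S id_fun H \<alpha>
    using assms id by (intro cospan_invariant.intro)
  \<comment> \<open>The hypothesis on \<open>S\<close> has target \<open>coproduct_smcat B\<close>.
    To take the place of \<open>T\<close>, it must be a functor into \<open>B\<close> itself, which
    has the same objects, arrows and composition.\<close>
  have "cat_functor Cs B S"
    by (intro cat_functor.intro cat_functor_axioms.intro Cs.category_axioms B)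
      (auto simp: S_Ob S_Hom S_Ide S_Comp)
  then interpret J: cospan_invariant B Cs Cs S S H \<alpha>
    using assms by (intro cospan_invariant.intro)
  have case_i: "\<sigma> X k = I.\<tau> X k"
    if \<sigma>: "ab_nat_trans B I.K (comp_fun H id_fun) \<sigma>"
      and eq: "\<forall>V \<in> Ob Cs. \<sigma> (FO S V) (K_class Cs B S H \<alpha> id_fun (V, FO S V, Ide B (FO S V))) = \<alpha> V"
      and X: "X \<in> Ob B" and k: "k \<in> carrier (FO I.K X)" for \<sigma> X k
    using \<sigma> X k
  proof (rule I.ab_nat_trans_eq_tau)
    fix V h assume "I.triple V X h"
    then have V: "V \<in> Ob Cs" and h: "h \<in> Hom B (FO S V) X"
      by (auto simp: I.triple_def)
    \<comment> \<open>For the identity functor, \<open>h\<close> is its own lift: the triple comes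
      from the identity triple over \<open>FO S V\<close> along \<open>h\<close>.\<close>
    show "\<sigma> X (K_class Cs B S H \<alpha> id_fun (V, X, h)) = FA H h (\<alpha> V)"
      using I.ab_nat_trans_K_class[OF \<sigma> V h] eq V by simp
  qed
  have case_ii: "\<sigma> X k = J.\<tau> X k"
    if full: "full_functor Cs B S"
      and \<sigma>: "ab_nat_trans Cs J.K (comp_fun H S) \<sigma>"
      and eq: "\<forall>V \<in> Ob Cs. \<sigma> V (K_class Cs B S H \<alpha> S (V, V, Ide B (FO S V))) = \<alpha> V"
      and X: "X \<in> Ob Cs" and k: "k \<in> carrier (FO J.K X)" for \<sigma> X k
    using \<sigma> X k
  proof (rule J.ab_nat_trans_eq_tau)
    fix V h assume "J.triple V X h"
    then have V: "V \<in> Ob Cs" and h: "h \<in> Hom B (FO S V) (FO S X)"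
      by (auto simp: J.triple_def)
    \<comment> \<open>An arrow between images of \<open>S\<close> need not come from
      \<open>Cs\<close> in general; fullness supplies the lift \<open>f\<close> along which
      naturality is applied.\<close>
    then have "h \<in> FA S ` Hom Cs V X" using full X by (simp add: full_functor_def)
    then obtain f where f: "f \<in> Hom Cs V X" "h = FA S f" by blast
    show "\<sigma> X (K_class Cs B S H \<alpha> S (V, X, h)) = FA H h (\<alpha> V)"
      using J.ab_nat_trans_K_class[OF \<sigma> V f(1)] eq V f(2) by simp
  qed
  have "\<forall>X \<in> Ob Ct. \<forall>V \<in> Ob Cs. \<forall>h \<in> Hom B (FO S V) (FO T X).
      \<tau> X (K_class Cs B S H \<alpha> T (V, X, h)) = FA H h (\<alpha> V)"
    by (simp add: tau_K_class triple_def)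
  moreover have "\<forall>V \<in> Ob Cs. I.\<tau> (FO S V)
      (K_class Cs B S H \<alpha> id_fun (V, FO S V, Ide B (FO S V))) = \<alpha> V"
  proof
    fix V assume V: "V \<in> Ob Cs"
    then have "I.triple V (FO S V) (Ide B (FO S V))"
      using S_Ob S_Ide_Hom by (simp add: I.triple_def)
    then show "I.\<tau> (FO S V) (K_class Cs B S H \<alpha> id_fun (V, FO S V, Ide B (FO S V))) = \<alpha> V"
      using V by (simp add: I.tau_K_class H.FA_Ide S_Ob value_in)
  qed
  moreover have "\<forall>V \<in> Ob Cs. J.\<tau> V (K_class Cs B S H \<alpha> S (V, V, Ide B (FO S V))) = \<alpha> V"
  proof
    fix V assume V: "V \<in> Ob Cs"
    then have "J.triple V V (Ide B (FO S V))"
      using S_Ide_Hom by (simp add: J.triple_def)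
    then show "J.\<tau> V (K_class Cs B S H \<alpha> S (V, V, Ide B (FO S V))) = \<alpha> V"
      using V by (simp add: J.tau_K_class H.FA_Ide S_Ob value_in)
  qed
  ultimately show ?thesis
    using ab_nat_trans_tau I.ab_nat_trans_tau J.ab_nat_trans_tau case_i case_ii by blast
qed

end
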